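(* Let $Q:\rho(A_0)\to\mathscr C(\mathsf Y,\mathsf X)$, $z\mapsto Q_z$, be a map with values in the closed linear operators from $\mathsf Y$ to $\mathsf X$ such that: (i) $\mathrm{dom}(Q_z)=\mathsf D$ does not depend on $z$, and $\mathsf D$ is dense in $\mathsf Y$; (ii) $Q_z=Q_w+(z-w)\,V G_{\bar w}^{*}G_zW$ for all $z,w\in\rho(A_0)$; (iii) $V^{*}(Q_z^{*})^{-1}W^{*}=W Q_{\bar z}^{-1}V$ for all $z\in Z_Q$, where $$Z_Q:=\{z\in\rho(A_0): Q_z \text{ and } Q_{\bar z}\text{ are bijections from }\mathsf D\text{ onto }\mathsf X\text{ with inverses in }\mathscr B(\mathsf X,\mathsf Y)\}.$$ Suppose $Z_Q\neq\emptyset$, and let $A_Q$ be the self-adjoint operator associated with $Q$ (see context). Then $$Z_Q=\rho(A_0)\cap\rho(A_Q).$$ Moreover, for every $z\in\rho(A_0)\cap\rho(A_Q)$ and every choice of $w\in Z_Q$ one has $Q_z^{-1}=\widehat\Lambda^Q_z$, where $$\widehat\Lambda^{Q}_{z}:=Q_{w}^{-1}+(w-z)\,Q_{w}^{-1}V G_{\bar w}^{*}\left(1+(w-z)(-A_Q+z)^{-1}\right)G_{w}W Q_{w}^{-1},$$ and the resolvent formula $$(-A_Q+z)^{-1}=(-A_0+z)^{-1}+G_zWQ_z^{-1}VG_{\bar z}^{*},\qquad z\in\rho(A_0)\cap\rho(A_Q),$$ holds.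
   Context: Setting. $\mathsf H$, $\mathsf K$, $\mathsf X$, $\mathsf Y$ are complex Hilbert spaces, with scalar products conjugate-linear in the first variable. $\mathscr B(\cdot,\cdot)$ denotes bounded everywhere defined linear operators and $\mathscr C(\cdot,\cdot)$ closed linear operators. $\mathsf K$ is not identified with its dual $\mathsf K^*$, but $\mathsf K^{**}\equiv\mathsf K$; the $\mathsf K^*$-$\mathsf K$ pairing is $\langle\psi,\phi\rangle_{\mathsf K^*,\mathsf K}:=\langle J^{-1}\psi,\phi\rangle_{\mathsf K}$ with $J:\mathsf K\to\mathsf K^*$ the duality mapping (treated as a linear isometric isomorphism, so that the pairing is conjugate-linear in $\psi$ and linear in $\phi$); similarly for $\mathsf X,\mathsf Y$. Adjoints are taken with respect to these pairings (and $\mathsf H^*$ is identified with $\mathsf H$). $A_0:\mathrm{dom}(A_0)\subseteq\mathsf H\to\mathsf H$ is self-adjoint, $\rho(\cdot)$ denotes the resolvent set, and $\tau:\mathrm{dom}(A_0)\to\mathsf K$ is linear, continuous with respect to the graph norm, with $\ker(\tau)$ dense in $\mathsf H$ (it is not assumed that $\tau$ is surjective). For $z\in\rho(A_0)$ put $R^0_z:=(-A_0+z)^{-1}$ and $G_z:=(\tau R^0_{\bar z})^*\in\mathscr B(\mathsf K^*,\mathsf H)$, so that $G_{\bar z}^*=\tau R^0_z$. $V\in\mathscr B(\mathsf K,\mathsf X)$ and $W\in\mathscr B(\mathsf Y,\mathsf K^* )$ are fixed bounded operators. Definition of $A_Q$ (known result). Let $Z_\Lambda\subseteq\rho(A_0)$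 be nonempty and symmetric with respect to the real axis, and let $\Lambda:Z_\Lambda\to\mathscr B(\mathsf X,\mathsf Y)$ satisfy $V^*\Lambda_z^*W^*=W\Lambda_{\bar z}V$ and $\Lambda_z-\Lambda_w=(w-z)\Lambda_wVG_{\bar w}^*G_zW\Lambda_z$ for all $z,w\in Z_\Lambda$. Then there is a unique self-adjoint extension $A_\Lambda$ of the closed symmetric operator $S:=A_0|\ker(\tau)$ such that $Z_\Lambda\subseteq\rho(A_0)\cap\rho(A_\Lambda)$ and $(-A_\Lambda+z)^{-1}=R^0_z+G_zW\Lambda_zVG_{\bar z}^*$ for all $z\in Z_\Lambda$. If $Q$ satisfies (i)-(iii) and $Z_Q\ne\emptyset$, then $\Lambda^Q:Z_Q\to\mathscr B(\mathsf X,\mathsf Y)$, $\Lambda^Q_z:=Q_z^{-1}$, satisfies these two identities, and $A_Q:=A_{\Lambda^Q}$. Thus $A_Q$ is the unique self-adjoint extension of $S$ with $Z_Q\subseteq\rho(A_0)\cap\rho(A_Q)$ and $(-A_Q+z)^{-1}=R^0_z+G_zWQ_z^{-1}VG_{\bar z}^*$ for $z\in Z_Q$. In (iii), for $z\in Z_Q$ the operator $Q_z^*$ is invertible with $(Q_z^* )^{-1}=(Q_z^{-1})^*$ bounded. *)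

theory Defs
  imports "HOL-Analysis.Analysis"
begin

section \<open>Complex Hilbert spaces\<close>

class complex_normed_space = real_normed_vector +
  fixes scaleC :: "complex \<Rightarrow> 'a \<Rightarrow> 'a" (infixr \<open>*\<^sub>C\<close> 75)
  assumes scaleC_add_right: "a *\<^sub>C (x + y) = a *\<^sub>C x + a *\<^sub>C y"
    and scaleC_add_left: "(a + b) *\<^sub>C x = a *\<^sub>C x + b *\<^sub>C x"
    and scaleC_scaleC: "a *\<^sub>C (b *\<^sub>C x) = (a * b) *\<^sub>C x"
    and scaleC_of_real: "complex_of_real r *\<^sub>C x = r *\<^sub>R x"
    and norm_scaleC: "norm (a *\<^sub>C x) = cmod a * norm x"

text \<open>The scalar product is conjugate-linear in the first variable. Its real part is the
  library's real inner product, so that the norm is the one induced by \<open>cinner\<close>.\<close>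

class complex_hilbert_space = complex_normed_space + real_inner + complete_space +
  fixes cinner :: "'a \<Rightarrow> 'a \<Rightarrow> complex"
  assumes cinner_commute: "cinner x y = cnj (cinner y x)"
    and cinner_add_right: "cinner x (y + z) = cinner x y + cinner x z"
    and cinner_scaleC_right: "cinner x (a *\<^sub>C y) = a * cinner x y"
    and Re_cinner: "Re (cinner x y) = inner x y"

instantiation complex :: complex_hilbert_space
begin
definition scaleC_complex :: "complex \<Rightarrow> complex \<Rightarrow> complex" where "scaleC_complex a x = a * x"
definition cinner_complex :: "complex \<Rightarrow> complex \<Rightarrow> complex" where "cinner_complex x y = cnj x * y"
instance
  by standard (simp_all add: scaleC_complex_def cinner_complex_def algebra_simps norm_mult
      scaleR_conv_of_real inner_complex_def)
end

lemma scaleC_zero_left [simp]: "0 *\<^sub>C x = 0"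
  using scaleC_of_real[of 0 x] by simp

lemma scaleC_one [simp]: "1 *\<^sub>C x = x"
  using scaleC_of_real[of 1 x] by simp

lemma scaleC_zero_right [simp]: "a *\<^sub>C 0 = 0"
  using scaleC_add_right[of a 0 0] by simp

lemma cinner_self: "cinner x x = complex_of_real ((norm x)\<^sup>2)"
proof -
  have "Im (cinner x x) = 0"
    using arg_cong[OF cinner_commute[of x x], of Im] by simp
  then show ?thesis
    by (simp add: complex_eq_iff Re_cinner power2_norm_eq_inner)
qed

definition bounded_clinear :: "('a::complex_normed_space \<Rightarrow> 'b::complex_normed_space) \<Rightarrow> bool" where
  "bounded_clinear f \<longleftrightarrow> bounded_linear f \<and> (\<forall>c x. f (c *\<^sub>C x) = c *\<^sub>C f x)"


section \<open>The dual space\<close>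

text \<open>Elements of the dual are the bounded complex-linear functionals with the operator norm. Scalar
  multiplication on the dual is conjugated, \<open>(c \<psi>)(x) = cnj c * \<psi> x\<close>: this is the structure
  which makes the duality mapping linear rather than conjugate-linear.\<close>

typedef (overloaded) 'a dual =
  "{f :: 'a::complex_normed_space \<Rightarrow>\<^sub>L complex. \<forall>c x. blinfun_apply f (c *\<^sub>C x) = c * blinfun_apply f x}"
  by (rule exI[of _ 0]) simp

setup_lifting type_definition_dual

lift_definition dual_apply :: "'a::complex_normed_space dual \<Rightarrow> 'a \<Rightarrow> complex" is blinfun_apply .

lemma dual_eqI: "(\<And>x. dual_apply f x = dual_apply g x) \<Longrightarrow> f = g"
  by transfer (simp add: blinfun_eqI)

lemma bounded_linear_dual_apply: "bounded_linear (dual_apply f)"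
  by transfer (rule blinfun.bounded_linear_right)

lemma dual_apply_scaleC_right: "dual_apply f (c *\<^sub>C x) = c * dual_apply f x"
  by transfer simp

lemma bounded_linear_scaleC: "bounded_linear (\<lambda>x. c *\<^sub>C (x::'a::complex_normed_space))"
proof (rule bounded_linear_intro[where K="cmod c"])
  show "c *\<^sub>C (r *\<^sub>R x) = r *\<^sub>R (c *\<^sub>C x)" for r and x :: 'a
    by (metis scaleC_of_real scaleC_scaleC mult.commute)
qed (simp_all add: scaleC_add_right norm_scaleC)

instantiation dual :: (complex_normed_space) complex_normed_space
begin

lift_definition zero_dual :: "'a dual" is 0 by simp
lift_definition plus_dual :: "'a dual \<Rightarrow> 'a dual \<Rightarrow> 'a dual" is "(+)"
  by (simp add: blinfun.add_left algebra_simps)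
lift_definition minus_dual :: "'a dual \<Rightarrow> 'a dual \<Rightarrow> 'a dual" is "(-)"
  by (simp add: blinfun.diff_left algebra_simps)
lift_definition uminus_dual :: "'a dual \<Rightarrow> 'a dual" is "uminus"
  by (simp add: blinfun.minus_left)
lift_definition scaleR_dual :: "real \<Rightarrow> 'a dual \<Rightarrow> 'a dual" is "scaleR"
  by (simp add: blinfun.scaleR_left)
lift_definition scaleC_dual :: "complex \<Rightarrow> 'a dual \<Rightarrow> 'a dual"
  is "\<lambda>c f. blinfun_compose (Blinfun (\<lambda>y. cnj c * y)) f"
  by (simp add: bounded_linear_Blinfun_apply bounded_linear_mult_right)
lift_definition norm_dual :: "'a dual \<Rightarrow> real" is norm .

definition dist_dual :: "'a dual \<Rightarrow> 'a dual \<Rightarrow> real" where "dist_dual f g = norm (f - g)"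
definition sgn_dual :: "'a dual \<Rightarrow> 'a dual" where "sgn_dual f = scaleR (inverse (norm f)) f"
definition uniformity_dual :: "('a dual \<times> 'a dual) filter" where
  "uniformity_dual = (INF e\<in>{0<..}. principal {(x, y). dist x y < e})"
definition open_dual :: "'a dual set \<Rightarrow> bool" where
  "open_dual U \<longleftrightarrow> (\<forall>x\<in>U. eventually (\<lambda>(x', y). x' = x \<longrightarrow> y \<in> U) uniformity)"

lemma dual_apply_scaleC: "dual_apply (scaleC c f) x = cnj c * dual_apply f x"
  by transfer (simp add: bounded_linear_Blinfun_apply bounded_linear_mult_right)

instance
proof
  fix f g h :: "'a dual" and r s :: real and a b :: complex
  show "f + g + h = f + (g + h)" by transfer (rule add.assoc)
  show "f + g = g + f" by transfer (rule add.commute)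
  show "0 + f = f" by transfer simp
  show "- f + f = 0" by transfer simp
  show "f - g = f + - g" by transfer simp
  show "r *\<^sub>R (f + g) = r *\<^sub>R f + r *\<^sub>R g" by transfer (rule scaleR_add_right)
  show "(r + s) *\<^sub>R f = r *\<^sub>R f + s *\<^sub>R f" by transfer (rule scaleR_add_left)
  show "r *\<^sub>R s *\<^sub>R f = (r * s) *\<^sub>R f" by transfer simp
  show "1 *\<^sub>R f = f" by transfer simp
  show "norm f = 0 \<longleftrightarrow> f = 0" by transfer simp
  show "norm (f + g) \<le> norm f + norm g" by transfer (rule norm_triangle_ineq)
  show "norm (r *\<^sub>R f) = \<bar>r\<bar> * norm f" by transfer simp
  have add: "dual_apply (f + g) x = dual_apply f x + dual_apply g x" for f g :: "'a dual" and x
    by transfer (simp add: blinfun.add_left)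
  have scR: "dual_apply (r *\<^sub>R f) x = r *\<^sub>R dual_apply f x" for r and f :: "'a dual" and x
    by transfer (simp add: blinfun.scaleR_left)
  show "scaleC a (f + g) = scaleC a f + scaleC a g"
    by (rule dual_eqI) (simp add: dual_apply_scaleC add algebra_simps)
  show "scaleC (a + b) f = scaleC a f + scaleC b f"
    by (rule dual_eqI) (simp add: dual_apply_scaleC add algebra_simps)
  show "scaleC a (scaleC b f) = scaleC (a * b) f"
    by (rule dual_eqI) (simp add: dual_apply_scaleC)
  show "scaleC (complex_of_real r) f = r *\<^sub>R f"
    by (rule dual_eqI) (simp add: dual_apply_scaleC scR scaleR_conv_of_real)
  show "norm (scaleC a f) = cmod a * norm f"
  proof transfer
    fix a and f :: "'a \<Rightarrow>\<^sub>L complex"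
    let ?g = "blinfun_compose (Blinfun (\<lambda>y. cnj a * y)) f"
    have ap: "blinfun_apply ?g x = cnj a * blinfun_apply f x" for x
      by (simp add: bounded_linear_Blinfun_apply bounded_linear_mult_right)
    show "norm ?g = cmod a * norm f"
    proof (rule antisym)
      show "norm ?g \<le> cmod a * norm f"
      proof (rule norm_blinfun_bound)
        show "norm (blinfun_apply ?g x) \<le> cmod a * norm f * norm x" for x
          unfolding ap using norm_blinfun[of f x]
          by (simp add: norm_mult mult.assoc mult_left_mono)
      qed simp
      show "cmod a * norm f \<le> norm ?g"
      proof (cases "a = 0")
        case False
        have "norm f \<le> norm ?g / cmod a"
        proof (rule norm_blinfun_bound)
          show "norm (blinfun_apply f x) \<le> norm ?g / cmod a * norm x" for x
            using norm_blinfun[of ?g x] False unfolding ap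
            by (simp add: norm_mult field_simps)
        qed simp
        with False show ?thesis by (simp add: field_simps)
      qed simp
    qed
  qed
qed (simp_all add: dist_dual_def sgn_dual_def uniformity_dual_def open_dual_def)

end

lemma dual_apply_add: "dual_apply (f + g) x = dual_apply f x + dual_apply g x"
  by transfer (simp add: blinfun.add_left)

lemma norm_dual_apply: "norm (dual_apply f x) \<le> norm f * norm x"
  by transfer (rule norm_blinfun)

lemma cinner_add_left: "cinner (x + y) z = cinner x z + cinner y z"
  by (metis cinner_commute cinner_add_right complex_cnj_add)

lemma cinner_scaleC_left: "cinner (a *\<^sub>C x) y = cnj a * cinner x y"
  by (metis cinner_commute cinner_scaleC_right complex_cnj_mult)

lemma cmod_cinner_le: "cmod (cinner x y) \<le> norm x * norm y"
proof (cases "cinner x y = 0")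
  case False
  define c where "c = cnj (cinner x y) / cmod (cinner x y)"
  have c: "cmod c = 1" using False by (simp add: c_def norm_divide)
  have "c * cinner x y = complex_of_real (cmod (cinner x y))"
    using False unfolding c_def
    by (simp add: field_simps complex_norm_square[symmetric] power2_eq_square)
  then have "cmod (cinner x y) = Re (cinner x (c *\<^sub>C y))"
    by (simp add: cinner_scaleC_right)
  also have "\<dots> = inner x (c *\<^sub>C y)" by (rule Re_cinner)
  also have "\<dots> \<le> norm x * norm (c *\<^sub>C y)" by (rule norm_cauchy_schwarz)
  finally show ?thesis by (simp add: norm_scaleC c)
qed simp

lemma bounded_linear_cinner_right: "bounded_linear (cinner x)"
proof (rule bounded_linear_intro[where K="norm x"])
  show "cinner x (r *\<^sub>R y) = r *\<^sub>R cinner x y" for r y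
    by (metis cinner_scaleC_right scaleC_of_real scaleR_conv_of_real)
qed (simp_all add: cinner_add_right cmod_cinner_le mult.commute[of _ "norm x"])

lift_definition duality_map :: "'a::complex_hilbert_space \<Rightarrow> 'a dual" is "\<lambda>x. Blinfun (cinner x)"
  by (simp add: bounded_linear_Blinfun_apply bounded_linear_cinner_right cinner_scaleC_right)

lemma dual_apply_duality_map: "dual_apply (duality_map x) y = cinner x y"
  by transfer (simp add: bounded_linear_Blinfun_apply bounded_linear_cinner_right)

lemma duality_map_add: "duality_map (x + y) = duality_map x + duality_map y"
  by (rule dual_eqI) (simp add: dual_apply_duality_map dual_apply_add cinner_add_left)

lemma duality_map_scaleC: "duality_map (c *\<^sub>C x) = c *\<^sub>C duality_map x"
  by (rule dual_eqI) (simp add: dual_apply_duality_map dual_apply_scaleC cinner_scaleC_left)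

lemma norm_duality_map: "norm (duality_map x) = norm x"
proof (rule antisym)
  show "norm (duality_map x) \<le> norm x"
    by transfer (rule norm_blinfun_bound, simp_all add: bounded_linear_Blinfun_apply
        bounded_linear_cinner_right cmod_cinner_le)
  have "norm x * norm x \<le> norm (duality_map x) * norm x"
    using norm_dual_apply[of "duality_map x" x]
    by (simp add: dual_apply_duality_map cinner_self norm_power power2_eq_square norm_mult)
  then show "norm x \<le> norm (duality_map x)"
    by (cases "norm x = 0") (auto simp: mult_le_cancel_right)
qed

text \<open>The Riesz representation theorem, by minimizing \<open>norm x ^ 2 / 2 - g x\<close>.\<close>

lemma real_riesz:
  fixes g :: "'a::{real_inner,complete_space} \<Rightarrow> real"
  assumes g: "bounded_linear g"
  obtains a where "\<And>x. g x = inner a x"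
proof -
  interpret g: bounded_linear g by fact
  define F where "F x = (norm x)\<^sup>2 / 2 - g x" for x
  obtain K where K: "\<And>x. norm (g x) \<le> norm x * K" using g.bounded by blast
  have low: "- K\<^sup>2 / 2 \<le> F x" for x
  proof -
    have "g x \<le> norm x * K" using K[of x] by simp
    moreover have "0 \<le> (norm x - K)\<^sup>2" by simp
    ultimately show ?thesis unfolding F_def by (simp add: power2_diff)
  qed
  define m where "m = (INF x. F x)"
  have bdd: "bdd_below (range F)" by (rule bdd_belowI2) (rule low)
  have mle: "m \<le> F x" for x unfolding m_def using bdd by (rule cINF_lower) simp
  have "\<exists>x. F x < m + inverse (Suc n)" for n
  proof -
    have "Inf (range F) < m + inverse (Suc n)" by (simp add: m_def)
    then show ?thesis using cInf_lessD[of "range F"] by fastforce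
  qed
  then obtain X where X: "\<And>n. F (X n) < m + inverse (Suc n)" by metis
  have par: "(norm (x - y))\<^sup>2 = 4 * (F x + F y - 2 * F ((1/2) *\<^sub>R (x + y)))" for x y
    unfolding F_def g.scaleR g.add power2_norm_eq_inner
    by (simp add: inner_simps inner_commute field_simps)
  have "Cauchy X"
  proof (rule metric_CauchyI)
    fix e :: real assume e: "0 < e"
    then obtain N where N: "inverse (real (Suc N)) < e\<^sup>2 / 8"
      using reals_Archimedean[of "e\<^sup>2 / 8"] by auto
    have "dist (X i) (X j) < e" if "N \<le> i" "N \<le> j" for i j
    proof -
      have "F (X i) < m + e\<^sup>2 / 8" "F (X j) < m + e\<^sup>2 / 8"
        using X[of i] X[of j] N that
          le_imp_inverse_le[of "real (Suc N)" "real (Suc i)"]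
          le_imp_inverse_le[of "real (Suc N)" "real (Suc j)"] by linarith+
      then have "(norm (X i - X j))\<^sup>2 < e\<^sup>2"
        using par[of "X i" "X j"] mle[of "(1/2) *\<^sub>R (X i + X j)"] by simp
      then show ?thesis using e by (simp add: dist_norm power_less_imp_less_base)
    qed
    then show "\<exists>M. \<forall>i\<ge>M. \<forall>j\<ge>M. dist (X i) (X j) < e" by blast
  qed
  then obtain a where a: "X \<longlonglongrightarrow> a" using Cauchy_convergent convergent_def by blast
  have "(\<lambda>n. F (X n)) \<longlonglongrightarrow> F a"
    unfolding F_def by (intro tendsto_intros a g.tendsto) simp
  moreover have "(\<lambda>n. m + inverse (real (Suc n))) \<longlonglongrightarrow> m + 0"
    by (intro tendsto_intros LIMSEQ_inverse_real_of_nat)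
  ultimately have "F a \<le> m + 0"
    by (rule LIMSEQ_le) (use X less_imp_le in blast)
  then have min: "F a \<le> F y" for y using mle[of y] by simp
  have "g x = inner a x" for x
  proof (rule ccontr)
    assume ne: "g x \<noteq> inner a x"
    define d where "d = inner a x - g x"
    define s where "s = (norm x)\<^sup>2"
    have s: "0 \<le> s" by (simp add: s_def)
    have q: "0 \<le> t * d + t\<^sup>2 * s / 2" for t
    proof -
      have "F (a + t *\<^sub>R x) = F a + (t * d + t\<^sup>2 * s / 2)"
        unfolding F_def g.add g.scaleR power2_norm_eq_inner d_def s_def
        by (simp add: inner_simps inner_commute algebra_simps power2_eq_square)
      with min[of "a + t *\<^sub>R x"] show ?thesis by simp
    qed
    have "- (d\<^sup>2 / (s + 1)) + d\<^sup>2 * s / (s + 1)\<^sup>2 / 2 < 0"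
    proof -
      have "0 < s * s + (2 + s * 3)" using mult_nonneg_nonneg[OF s s] s by linarith
      then have "s / (s + 1)\<^sup>2 / 2 < 1 / (s + 1)"
        using s by (simp add: field_simps power2_eq_square add_pos_nonneg)
      moreover have "d\<^sup>2 > 0" using ne by (simp add: d_def)
      ultimately have "d\<^sup>2 * (s / (s + 1)\<^sup>2 / 2) < d\<^sup>2 * (1 / (s + 1))"
        by (rule mult_strict_left_mono)
      then show ?thesis by simp
    qed
    then show False
      using q[of "- d / (s + 1)"] by (simp add: power2_eq_square)
  qed
  then show thesis by (rule that)
qed

lemma bij_duality_map: "bij (duality_map :: 'a::complex_hilbert_space \<Rightarrow> 'a dual)"
proof (rule bijI)
  show "inj (duality_map :: 'a \<Rightarrow> 'a dual)"
  proof (rule injI)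
    fix x y :: 'a assume "duality_map x = duality_map y"
    then have "cinner x z = cinner y z" for z by (metis dual_apply_duality_map)
    then have "inner x z = inner y z" for z by (metis Re_cinner)
    then show "x = y" by (metis vector_eq_rdot)
  qed
  show "surj (duality_map :: 'a \<Rightarrow> 'a dual)"
    unfolding surj_def
  proof
    fix f :: "'a dual"
    have "bounded_linear (\<lambda>x. Re (dual_apply f x))"
      by (rule bounded_linear_compose[OF bounded_linear_Re bounded_linear_dual_apply])
    then obtain a where a: "\<And>x. Re (dual_apply f x) = inner a x"
      by (rule real_riesz) auto
    have "f = duality_map a"
    proof (rule dual_eqI)
      fix x
      have "Im z = Re (- \<i> * z)" for z by simp
      then have "Im (dual_apply f x) = Re (dual_apply f ((- \<i>) *\<^sub>C x))"
        "Im (cinner a x) = Re (cinner a ((- \<i>) *\<^sub>C x))"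
        by (metis dual_apply_scaleC_right, metis cinner_scaleC_right)
      then show "dual_apply f x = dual_apply (duality_map a) x"
        by (simp add: dual_apply_duality_map complex_eq_iff a Re_cinner)
    qed
    then show "\<exists>x. f = duality_map x" by blast
  qed
qed

definition pairing :: "'a::complex_hilbert_space dual \<Rightarrow> 'a \<Rightarrow> complex" where
  "pairing \<psi> \<phi> = cinner (inv duality_map \<psi>) \<phi>"

lemma pairing_eq_dual_apply: "pairing \<psi> \<phi> = dual_apply \<psi> \<phi>"
  by (metis pairing_def dual_apply_duality_map bij_duality_map bij_inv_eq_iff)

text \<open>The pairing between \<open>K** = K\<close> and \<open>K*\<close>.\<close>

definition copairing :: "'a::complex_hilbert_space \<Rightarrow> 'a dual \<Rightarrow> complex" where
  "copairing \<phi> \<psi> = cnj (pairing \<psi> \<phi>)"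


section \<open>Unbounded operators\<close>

text \<open>An operator with domain \<open>Domain T\<close> is represented by its graph \<open>T\<close>; thus the inverse is the
  converse relation \<open>T\<inverse>\<close>, and \<open>S \<subseteq> T\<close> says that \<open>T\<close> extends \<open>S\<close>. Everywhere defined operators
  are functions.\<close>

definition linear_op ::
    "('a::complex_normed_space \<times> 'b::complex_normed_space) set \<Rightarrow> bool" where
  "linear_op T \<longleftrightarrow> single_valued T \<and> (0, 0) \<in> T \<and>
     (\<forall>x y x' y'. (x, y) \<in> T \<longrightarrow> (x', y') \<in> T \<longrightarrow> (x + x', y + y') \<in> T) \<and>
     (\<forall>c x y. (x, y) \<in> T \<longrightarrow> (c *\<^sub>C x, c *\<^sub>C y) \<in> T)"

definition closed_op ::
    "('a::complex_normed_space \<times> 'b::complex_normed_space) set \<Rightarrow> bool" where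
  "closed_op T \<longleftrightarrow> linear_op T \<and> closed T"

definition op_app :: "('a \<times> 'b) set \<Rightarrow> 'a \<Rightarrow> 'b" where
  "op_app T x = (THE y. (x, y) \<in> T)"

definition op_inv :: "('a \<times> 'b) set \<Rightarrow> 'b \<Rightarrow> 'a" where
  "op_inv T = op_app (T\<inverse>)"

definition graph_of :: "('a \<Rightarrow> 'b) \<Rightarrow> ('a \<times> 'b) set" where
  "graph_of f = {(x, f x) |x. True}"

definition boundedly_invertible ::
    "('a::complex_normed_space \<times> 'b::complex_normed_space) set \<Rightarrow> bool" where
  "boundedly_invertible T \<longleftrightarrow> bij_betw (op_app T) (Domain T) UNIV \<and> bounded_clinear (op_inv T)"

text \<open>The adjoint of an operator \<open>T\<close> from \<open>A\<close> to \<open>B\<close>, with respect to a pairing \<open>p\<close> of \<open>A*\<close> with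
  \<open>A\<close> and a pairing \<open>q\<close> of \<open>B*\<close> with \<open>B\<close>: it is an operator from \<open>B*\<close> to \<open>A*\<close>. For a Hilbert
  space identified with its dual the pairing is \<open>cinner\<close>.\<close>

definition op_adjoint ::
    "('a' \<Rightarrow> 'a \<Rightarrow> complex) \<Rightarrow> ('b' \<Rightarrow> 'b \<Rightarrow> complex) \<Rightarrow> ('a \<times> 'b) set \<Rightarrow> ('b' \<times> 'a') set" where
  "op_adjoint p q T = {(\<eta>, \<xi>). \<forall>x y. (x, y) \<in> T \<longrightarrow> q \<eta> y = p \<xi> x}"

definition adjoint_fun ::
    "('a' \<Rightarrow> 'a \<Rightarrow> complex) \<Rightarrow> ('b' \<Rightarrow> 'b \<Rightarrow> complex) \<Rightarrow> ('a \<Rightarrow> 'b) \<Rightarrow> 'b' \<Rightarrow> 'a'" where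
  "adjoint_fun p q f = op_app (op_adjoint p q (graph_of f))"

definition self_adjoint :: "('h::complex_hilbert_space \<times> 'h) set \<Rightarrow> bool" where
  "self_adjoint A \<longleftrightarrow> linear_op A \<and> closure (Domain A) = UNIV \<and> op_adjoint cinner cinner A = A"

text \<open>The operator \<open>-A + z\<close> with the domain of \<open>A\<close>.\<close>

definition shifted :: "('h::complex_normed_space \<times> 'h) set \<Rightarrow> complex \<Rightarrow> ('h \<times> 'h) set" where
  "shifted A z = {(u, z *\<^sub>C u - v) |u v. (u, v) \<in> A}"

definition resolvent_set :: "('h::complex_normed_space \<times> 'h) set \<Rightarrow> complex set" where
  "resolvent_set A = {z. boundedly_invertible (shifted A z)}"

definition resolvent :: "('h::complex_normed_space \<times> 'h) set \<Rightarrow> complex \<Rightarrow> 'h \<Rightarrow> 'h" where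
  "resolvent A z = op_inv (shifted A z)"


section \<open>Extensions of the restriction to the kernel of \<open>\<tau>\<close>\<close>

text \<open>The graph norm on \<open>Domain A0\<close> is the norm of the product space on the graph \<open>A0\<close>.\<close>

definition trace_map ::
    "('h::complex_hilbert_space \<times> 'h) set \<Rightarrow> ('h \<Rightarrow> 'k::complex_hilbert_space) \<Rightarrow> bool" where
  "trace_map A0 \<tau> \<longleftrightarrow>
     (\<forall>u\<in>Domain A0. \<forall>v\<in>Domain A0. \<tau> (u + v) = \<tau> u + \<tau> v) \<and>
     (\<forall>c. \<forall>u\<in>Domain A0. \<tau> (c *\<^sub>C u) = c *\<^sub>C \<tau> u) \<and>
     continuous_on A0 (\<lambda>(u, v). \<tau> u) \<and>
     closure {u \<in> Domain A0. \<tau> u = 0} = UNIV"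

text \<open>\<open>G_op A0 \<tau> z\<close> is the bounded operator \<open>(\<tau> R\<^sub>w)*\<close> with \<open>w = cnj z\<close>, and \<open>G_adj A0 \<tau> z\<close> is
  its adjoint, so that \<open>G_adj A0 \<tau> (cnj z) = \<tau> R\<^sub>z\<close>; here \<open>R\<^sub>z\<close> is \<open>resolvent A0 z\<close>.\<close>

definition G_op ::
    "('h::complex_hilbert_space \<times> 'h) set \<Rightarrow> ('h \<Rightarrow> 'k::complex_hilbert_space) \<Rightarrow> complex \<Rightarrow>
     'k dual \<Rightarrow> 'h" where
  "G_op A0 \<tau> z = adjoint_fun cinner pairing (\<lambda>u. \<tau> (resolvent A0 (cnj z) u))"

definition G_adj ::
    "('h::complex_hilbert_space \<times> 'h) set \<Rightarrow> ('h \<Rightarrow> 'k::complex_hilbert_space) \<Rightarrow> complex \<Rightarrow>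
     'h \<Rightarrow> 'k" where
  "G_adj A0 \<tau> z = adjoint_fun copairing cinner (G_op A0 \<tau> z)"

text \<open>The self-adjoint extension \<open>A\<^sub>\<Lambda>\<close> of the restriction of \<open>A0\<close> to the kernel of \<open>\<tau>\<close> which
  belongs to a map \<open>\<Lambda> = L\<close> on \<open>Z\<close>. It exists and is unique if \<open>Z\<close> is a nonempty subset of
  \<open>resolvent_set A0\<close> closed under conjugation and, for \<open>z\<close> and \<open>w\<close> in \<open>Z\<close>,
  \<open>V* (L z)* W* = W L(cnj z) V\<close> and \<open>L z - L w = (w - z) (L w) V G(cnj w)* G(z) W (L z)\<close>.\<close>

definition A_Lambda ::
    "('h::complex_hilbert_space \<times> 'h) set \<Rightarrow> ('h \<Rightarrow> 'k::complex_hilbert_space) \<Rightarrow>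
     ('k \<Rightarrow> 'x::complex_hilbert_space) \<Rightarrow> ('y::complex_hilbert_space \<Rightarrow> 'k dual) \<Rightarrow>
     complex set \<Rightarrow> (complex \<Rightarrow> 'x \<Rightarrow> 'y) \<Rightarrow> ('h \<times> 'h) set" where
  "A_Lambda A0 \<tau> V W Z L = (THE A. self_adjoint A \<and>
     {(u, v) \<in> A0. \<tau> u = 0} \<subseteq> A \<and>
     Z \<subseteq> resolvent_set A0 \<inter> resolvent_set A \<and>
     (\<forall>z\<in>Z. \<forall>u. resolvent A z u =
        resolvent A0 z u + G_op A0 \<tau> z (W (L z (V (G_adj A0 \<tau> (cnj z) u))))))"

text \<open>An operator that is \<open>boundedly_invertible\<close> is a bijection of its domain, here the
  common domain of the \<open>Q z\<close>, onto the whole space.\<close>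

definition Z_Q ::
    "('h::complex_hilbert_space \<times> 'h) set \<Rightarrow>
     (complex \<Rightarrow> ('y::complex_hilbert_space \<times> 'x::complex_hilbert_space) set) \<Rightarrow> complex set" where
  "Z_Q A0 Q = {z \<in> resolvent_set A0. boundedly_invertible (Q z) \<and> boundedly_invertible (Q (cnj z))}"

definition A_Q ::
    "('h::complex_hilbert_space \<times> 'h) set \<Rightarrow> ('h \<Rightarrow> 'k::complex_hilbert_space) \<Rightarrow>
     ('k \<Rightarrow> 'x::complex_hilbert_space) \<Rightarrow> ('y::complex_hilbert_space \<Rightarrow> 'k dual) \<Rightarrow>
     (complex \<Rightarrow> ('y \<times> 'x) set) \<Rightarrow> ('h \<times> 'h) set" where
  "A_Q A0 \<tau> V W Q = A_Lambda A0 \<tau> V W (Z_Q A0 Q) (\<lambda>z. op_inv (Q z))"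

definition Lambda_hat ::
    "('h::complex_hilbert_space \<times> 'h) set \<Rightarrow> ('h \<Rightarrow> 'k::complex_hilbert_space) \<Rightarrow>
     ('k \<Rightarrow> 'x::complex_hilbert_space) \<Rightarrow> ('y::complex_hilbert_space \<Rightarrow> 'k dual) \<Rightarrow>
     (complex \<Rightarrow> ('y \<times> 'x) set) \<Rightarrow> complex \<Rightarrow> complex \<Rightarrow> 'x \<Rightarrow> 'y" where
  "Lambda_hat A0 \<tau> V W Q w z x =
     (let g = G_op A0 \<tau> w (W (op_inv (Q w) x)) in
      op_inv (Q w) x + (w - z) *\<^sub>C op_inv (Q w) (V (G_adj A0 \<tau> (cnj w)
        (g + (w - z) *\<^sub>C resolvent (A_Q A0 \<tau> V W Q) z g))))"

end

theory Submission
  imports Defs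
begin

text \<open>Put \<open>R z = R0 z + G z W (Q z)\<inverse> V G(cnj z)*\<close> on \<open>Z_Q\<close>. By (ii) this family satisfies the resolvent
  identity, by (iii) it is compatible with adjoints, and \<open>R z (-A0 + z)\<close> is the identity on the dense
  kernel of \<open>\<tau>\<close>; hence it is the resolvent of a self-adjoint operator, which is \<open>A_Q\<close>. For \<open>z\<close> in
  both resolvent sets and \<open>w\<close> in \<open>Z_Q\<close>, (ii) and \<open>G z = (1 + (w - z) R0 z) G w\<close> exhibit \<open>Q z\<close> as a
  perturbation of \<open>Q w\<close> to which Woodbury's formula applies, with inverse \<open>Lambda_hat\<close>. Resolvent
  sets of self-adjoint operators are symmetric, so the same holds at \<open>cnj z\<close> and \<open>z\<close> lies in \<open>Z_Q\<close>,
  where the resolvent formula defines \<open>A_Q\<close>.\<close>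

section \<open>Bounded complex-linear maps\<close>

interpretation complex_scale: vector_space "scaleC :: complex \<Rightarrow> 'a \<Rightarrow> 'a::complex_normed_space"
  by standard (simp_all add: scaleC_add_right scaleC_add_left scaleC_scaleC)

lemma bounded_clinear_imp_bounded_linear: "bounded_clinear f \<Longrightarrow> bounded_linear f"
  by (simp add: bounded_clinear_def)

lemma bounded_clinear_scaleC: "bounded_clinear f \<Longrightarrow> f (c *\<^sub>C x) = c *\<^sub>C f x"
  by (simp add: bounded_clinear_def)

lemmas bounded_clinear_add = linear_add[OF bounded_linear.linear[OF bounded_clinear_imp_bounded_linear]]
lemmas bounded_clinear_diff = linear_diff[OF bounded_linear.linear[OF bounded_clinear_imp_bounded_linear]]
lemmas bounded_clinear_zero = linear_0[OF bounded_linear.linear[OF bounded_clinear_imp_bounded_linear]]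
lemmas bounded_clinear_simps =
  bounded_clinear_add bounded_clinear_diff bounded_clinear_zero bounded_clinear_scaleC

lemma bounded_clinearI:
  assumes "\<And>x y. f (x + y) = f x + f y" and "\<And>c x. f (c *\<^sub>C x) = c *\<^sub>C f x"
    and "\<And>x. norm (f x) \<le> norm x * K"
  shows "bounded_clinear f"
  unfolding bounded_clinear_def
proof
  show "bounded_linear f"
    by (rule bounded_linear_intro[OF assms(1) _ assms(3)]) (metis assms(2) scaleC_of_real)
qed (simp add: assms(2))

lemma bounded_clinear_ident: "bounded_clinear (\<lambda>x. x)"
  by (simp add: bounded_clinear_def bounded_linear_ident)

lemma bounded_clinear_compose:
  "bounded_clinear f \<Longrightarrow> bounded_clinear g \<Longrightarrow> bounded_clinear (\<lambda>x. f (g x))"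
  by (simp add: bounded_clinear_def bounded_linear_compose)

lemma bounded_clinear_plus:
  "bounded_clinear f \<Longrightarrow> bounded_clinear g \<Longrightarrow> bounded_clinear (\<lambda>x. f x + g x)"
  by (simp add: bounded_clinear_def bounded_linear_add scaleC_add_right)

lemma bounded_clinear_minus:
  "bounded_clinear f \<Longrightarrow> bounded_clinear g \<Longrightarrow> bounded_clinear (\<lambda>x. f x - g x)"
  by (simp add: bounded_clinear_def bounded_linear_sub complex_scale.scale_right_diff_distrib)

lemma bounded_clinear_scale:
  assumes "bounded_clinear f" shows "bounded_clinear (\<lambda>x. c *\<^sub>C f x)"
  using assms
  by (simp add: bounded_clinear_def bounded_linear_compose[OF bounded_linear_scaleC]
      complex_scale.scale_left_commute)

section \<open>Functionals, the dual space and the scalar product\<close>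

lemma bounded_clinear_dual_apply: "bounded_clinear (dual_apply \<psi>)"
  by (simp add: bounded_clinear_def bounded_linear_dual_apply dual_apply_scaleC_right scaleC_complex_def)

text \<open>Scalars act on the dual through their conjugates, so evaluation at \<open>x\<close> is
  conjugate-linear there; conjugating the value restores linearity.\<close>

lemma bounded_clinear_cnj_dual_apply: "bounded_clinear (\<lambda>\<psi>. cnj (dual_apply \<psi> x))"
  by (rule bounded_clinearI[where K="norm x"])
    (simp_all add: dual_apply_add dual_apply_scaleC scaleC_complex_def norm_dual_apply)

lemma bounded_clinear_functional_imp_dual:
  fixes f :: "'a::complex_normed_space \<Rightarrow> complex"
  assumes "bounded_clinear f"
  obtains \<psi> where "\<And>x. dual_apply \<psi> x = f x"
proof -
  have "dual_apply (Abs_dual (Blinfun f)) x = f x" for x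
    using assms
    by (simp add: dual_apply.rep_eq bounded_clinear_def Abs_dual_inverse bounded_linear_Blinfun_apply
        scaleC_complex_def)
  then show thesis by (rule that)
qed

lemma riesz_representation:
  fixes f :: "'a::complex_hilbert_space \<Rightarrow> complex"
  assumes "bounded_clinear f"
  obtains a where "\<And>x. cinner a x = f x"
proof -
  obtain \<psi> where \<psi>: "\<And>x. dual_apply \<psi> x = f x"
    using bounded_clinear_functional_imp_dual[OF assms] by blast
  obtain a where "\<psi> = duality_map a"
    using bij_duality_map by (metis bij_pointE)
  then have "cinner a x = f x" for x
    using \<psi>[of x] by (simp add: dual_apply_duality_map)
  then show thesis by (rule that)
qed

lemma cinner_diff_right: "cinner x (y - z) = cinner x y - cinner x z"
  using cinner_add_right[of x "y - z" z] by simp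

lemma cinner_diff_left: "cinner (x - y) z = cinner x z - cinner y z"
  using cinner_add_left[of "x - y" y z] by simp

lemma cinner_zero_left [simp]: "cinner 0 x = 0"
  using cinner_add_left[of 0 0 x] by simp

lemma bounded_clinear_cinner: "bounded_clinear (cinner x)"
  by (simp add: bounded_clinear_def bounded_linear_cinner_right cinner_scaleC_right scaleC_complex_def)

lemma cinner_extensionality:
  assumes "\<And>x. cinner a x = cinner b x"
  shows "a = b"
  using assms by (metis Re_cinner vector_eq_rdot)

lemma cinner_eq_zero_dense:
  assumes "closure S = UNIV" and "\<And>v. v \<in> S \<Longrightarrow> cinner u v = 0"
  shows "u = 0"
proof -
  have "closed {v. cinner u v = 0}"
    by (intro closed_Collect_eq continuous_intros
        bounded_linear.continuous_on[OF bounded_linear_cinner_right])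
  then have "closure S \<subseteq> {v. cinner u v = 0}"
    using assms(2) by (intro closure_minimal) auto
  then have "cinner u u = 0" using assms(1) by auto
  then show ?thesis by (simp add: cinner_self)
qed

text \<open>The functionals \<open>duality_map a\<close> are scalar products with \<open>a\<close>,
  and these already separate points.\<close>

lemma dual_apply_eq_imp_eq:
  fixes x y :: "'a::complex_hilbert_space"
  assumes "\<And>\<psi>. dual_apply \<psi> x = dual_apply \<psi> y"
  shows "x = y"
  by (rule cinner_extensionality) (metis assms cinner_commute dual_apply_duality_map)

text \<open>Serves \<open>\<tau>\<close>, which is given by continuity only: homogeneity turns
  continuity at 0 into a norm bound.\<close>

lemma bounded_clinear_of_continuous:
  assumes add: "\<And>x y. f (x + y) = f x + f y" and scale: "\<And>c x. f (c *\<^sub>C x) = c *\<^sub>C f x"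
    and cont: "continuous_on UNIV f"
  shows "bounded_clinear f"
proof -
  have "f 0 = 0" using scale[of 0 0] by simp
  moreover have "isCont f 0" using cont by (simp add: continuous_on_eq_continuous_at)
  ultimately obtain d where d: "0 < d" "\<And>x. norm x < d \<Longrightarrow> norm (f x) < 1"
    using LIM_D[of f "f 0" 0 1] by (auto simp: isCont_def) (metis norm_zero zero_less_one)
  have "norm (f x) \<le> norm x * (2 / d)" for x
  proof (cases "x = 0")
    case False
    \<comment> \<open>This factor scales \<open>x\<close> to norm \<open>d / 2\<close>, where
      \<open>f\<close> has norm below 1; undoing it gives the constant \<open>2 / d\<close>.\<close>
    define r where "r = d / (2 * norm x)"
    have r: "0 < r" using False d(1) by (simp add: r_def)
    have "norm (complex_of_real r *\<^sub>C x) = r * norm x" using r by (simp add: norm_scaleC)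
    also have "\<dots> < d" using False d(1) by (simp add: r_def)
    finally have "norm (complex_of_real r *\<^sub>C x) < d" .
    then have "norm (f (complex_of_real r *\<^sub>C x)) < 1" by (rule d(2))
    then have "r * norm (f x) < 1" using r by (simp add: scale norm_scaleC)
    then show ?thesis using False d(1) by (simp add: r_def field_simps)
  qed (simp add: \<open>f 0 = 0\<close>)
  then show ?thesis using add scale by (rule bounded_clinearI[rotated 2])
qed

section \<open>Adjoints, inverses and resolvents\<close>

lemma op_app_eqI: "single_valued T \<Longrightarrow> (x, y) \<in> T \<Longrightarrow> op_app T x = y"
  unfolding op_app_def by (rule the_equality) (auto dest: single_valuedD)

text \<open>That \<open>p\<close> separates points makes the adjoint relation single-valued, so the
  definite description in \<open>op_app\<close> selects \<open>\<xi>\<close>.\<close>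

lemma adjoint_fun_eqI:
  assumes "\<And>x. q \<eta> (f x) = p \<xi> x" and "\<And>\<xi> \<xi>'. (\<And>x. p \<xi> x = p \<xi>' x) \<Longrightarrow> \<xi> = \<xi>'"
  shows "adjoint_fun p q f \<eta> = \<xi>"
proof -
  have "single_valued (op_adjoint p q (graph_of f))"
    unfolding single_valued_def op_adjoint_def graph_of_def
    by (auto intro!: assms(2))
  then show ?thesis
    unfolding adjoint_fun_def
    by (rule op_app_eqI) (auto simp: op_adjoint_def graph_of_def assms(1))
qed

text \<open>Trades definite descriptions for a membership criterion: injectivity makes the converse
  relation single-valued, surjectivity makes it everywhere defined.\<close>

lemma boundedly_invertible_graph:
  assumes "single_valued T" "boundedly_invertible T"
  shows "(y, x) \<in> T \<longleftrightarrow> y = op_inv T x"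
proof -
  have inj: "inj_on (op_app T) (Domain T)" and surj: "op_app T ` Domain T = UNIV"
    using assms(2) by (auto simp: boundedly_invertible_def bij_betw_def)
  have sv: "single_valued (T\<inverse>)"
    by (rule single_valuedI) (metis DomainI assms(1) converseD inj inj_onD op_app_eqI)
  have eq: "op_inv T x' = y'" if "(y', x') \<in> T" for x' y'
    unfolding op_inv_def using sv that by (intro op_app_eqI) auto
  obtain y' where y': "y' \<in> Domain T" "op_app T y' = x"
    using surj by (metis UNIV_I imageE)
  then have "(y', x) \<in> T" using op_app_eqI[OF assms(1)] by blast
  then show ?thesis using eq by auto
qed

lemma boundedly_invertible_clinear: "boundedly_invertible T \<Longrightarrow> bounded_clinear (op_inv T)"
  by (simp add: boundedly_invertible_def)

lemma boundedly_invertibleI: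
  assumes sv: "single_valued T" and T: "\<And>y x. (y, x) \<in> T \<longleftrightarrow> y = L x" and L: "bounded_clinear L"
  shows "boundedly_invertible T \<and> op_inv T = L"
proof
  show inv: "op_inv T = L"
    unfolding op_inv_def
  proof
    show "op_app (T\<inverse>) x = L x" for x
      by (rule op_app_eqI) (auto intro: single_valuedI simp: T)
  qed
  have "op_app T (L x) = x" for x by (rule op_app_eqI[OF sv]) (simp add: T)
  moreover have "Domain T = range L" using T by auto
  ultimately have "bij_betw (op_app T) (Domain T) UNIV"
    by (intro bij_betw_byWitness[where f'=L]) auto
  then show "boundedly_invertible T" by (simp add: boundedly_invertible_def inv L)
qed

lemma linear_op_single_valued: "linear_op T \<Longrightarrow> single_valued T"
  by (simp add: linear_op_def)

section \<open>Resolvents as membership conditions on graphs\<close>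

lemma single_valued_shifted: "single_valued A \<Longrightarrow> single_valued (shifted A z)"
  unfolding single_valued_def shifted_def by blast

lemma mem_shifted_iff: "(u, f) \<in> shifted A z \<longleftrightarrow> (u, z *\<^sub>C u - f) \<in> A"
  unfolding shifted_def by (auto intro: exI[of _ "z *\<^sub>C u - f"])

lemma resolvent_clinear: "z \<in> resolvent_set A \<Longrightarrow> bounded_clinear (resolvent A z)"
  unfolding resolvent_set_def resolvent_def by (simp add: boundedly_invertible_clinear)

lemma resolvent_iff:
  assumes "linear_op A" "z \<in> resolvent_set A"
  shows "(u, z *\<^sub>C u - f) \<in> A \<longleftrightarrow> u = resolvent A z f"
  using boundedly_invertible_graph[OF single_valued_shifted, of A z u f] assms
  by (simp add: mem_shifted_iff resolvent_def resolvent_set_def linear_op_single_valued)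

lemma resolvent_in:
  "linear_op A \<Longrightarrow> z \<in> resolvent_set A \<Longrightarrow> (resolvent A z f, z *\<^sub>C resolvent A z f - f) \<in> A"
  by (simp add: resolvent_iff)

lemma resolvent_eq:
  "linear_op A \<Longrightarrow> z \<in> resolvent_set A \<Longrightarrow> (u, v) \<in> A \<Longrightarrow> resolvent A z (z *\<^sub>C u - v) = u"
  using resolvent_iff[of A z u "z *\<^sub>C u - v"] by simp

lemma resolventI:
  assumes "linear_op A" "bounded_clinear R" and "\<And>u f. (u, z *\<^sub>C u - f) \<in> A \<longleftrightarrow> u = R f"
  shows "z \<in> resolvent_set A \<and> resolvent A z = R"
  using boundedly_invertibleI[OF single_valued_shifted[OF linear_op_single_valued], of A z R] assms
  by (simp add: mem_shifted_iff resolvent_def resolvent_set_def)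

text \<open>With \<open>u = resolvent A z f\<close> and \<open>v = z *\<^sub>C u - f\<close>, the
  argument on the left is \<open>w *\<^sub>C u - v\<close>, which the resolvent at \<open>w\<close>
  sends back to \<open>u\<close>.\<close>

lemma resolvent_identity:
  assumes "linear_op A" "z \<in> resolvent_set A" "w \<in> resolvent_set A"
  shows "resolvent A w (f + (w - z) *\<^sub>C resolvent A z f) = resolvent A z f"
  using resolvent_eq[OF assms(1,3) resolvent_in[OF assms(1,2), of f]]
  by (simp add: complex_scale.scale_left_diff_distrib algebra_simps)

lemma resolvent_identity':
  assumes "linear_op A" "z \<in> resolvent_set A" "w \<in> resolvent_set A"
  shows "resolvent A z (f - (w - z) *\<^sub>C resolvent A w f) = resolvent A w f"
  using resolvent_identity[OF assms(1,3,2), of f]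
  by (simp add: complex_scale.scale_left_diff_distrib algebra_simps)

text \<open>Riesz is applied for each \<open>x\<close>; the bound comes from Cauchy-Schwarz for
  \<open>cinner x (R (R' x))\<close>, which is the square of \<open>norm (R' x)\<close>, after
  cancelling one factor.\<close>

lemma hilbert_adjoint_exists:
  fixes R :: "'a::complex_hilbert_space \<Rightarrow> 'b::complex_hilbert_space"
  assumes R: "bounded_clinear R"
  obtains R' where "bounded_clinear R'" "\<And>x u. cinner (R' x) u = cinner x (R u)"
proof -
  have "\<exists>a. \<forall>u. cinner a u = cinner x (R u)" for x
    using riesz_representation[OF bounded_clinear_compose[OF bounded_clinear_cinner R]] by metis
  then obtain R' where R': "\<And>x u. cinner (R' x) u = cinner x (R u)" by metis
  obtain K where K: "0 \<le> K" "\<And>u. norm (R u) \<le> norm u * K"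
    using bounded_linear.nonneg_bounded[OF bounded_clinear_imp_bounded_linear[OF R]] by blast
  have "bounded_clinear R'"
  proof (rule bounded_clinearI)
    show "R' (x + y) = R' x + R' y" for x y
      by (rule cinner_extensionality) (simp add: R' cinner_add_left)
    show "R' (c *\<^sub>C x) = c *\<^sub>C R' x" for c x
      by (rule cinner_extensionality) (simp add: R' cinner_scaleC_left)
    show "norm (R' x) \<le> norm x * K" for x
    proof (cases "R' x = 0")
      case True
      then show ?thesis using K(1) by simp
    next
      case False
      have "norm (R' x) * norm (R' x) = cmod (cinner (R' x) (R' x))"
        by (simp add: cinner_self power2_eq_square norm_mult)
      also have "\<dots> \<le> norm x * norm (R (R' x))" unfolding R' by (rule cmod_cinner_le)
      also have "\<dots> \<le> norm x * (norm (R' x) * K)" by (intro mult_left_mono K(2)) simp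
      finally have "norm (R' x) * norm (R' x) \<le> norm (R' x) * (norm x * K)"
        by (simp add: mult_ac)
      then show ?thesis using False by simp
    qed
  qed
  then show thesis using R' by (rule that)
qed

section \<open>Self-adjoint operators and conjugate points of the resolvent set\<close>

lemma self_adjoint_linear_op: "self_adjoint A \<Longrightarrow> linear_op A"
  by (simp add: self_adjoint_def)

lemma self_adjoint_symmetric:
  assumes "self_adjoint A" "(u, v) \<in> A" "(a, b) \<in> A"
  shows "cinner u b = cinner v a"
proof -
  have "(u, v) \<in> op_adjoint cinner cinner A" using assms by (simp add: self_adjoint_def)
  then show ?thesis using assms(3) by (auto simp: op_adjoint_def)
qed

lemma self_adjoint_memI:
  assumes "self_adjoint A" "\<And>a b. (a, b) \<in> A \<Longrightarrow> cinner u b = cinner v a"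
  shows "(u, v) \<in> A"
proof -
  have "(u, v) \<in> op_adjoint cinner cinner A" using assms(2) by (simp add: op_adjoint_def)
  then show ?thesis using assms(1) by (simp add: self_adjoint_def)
qed

text \<open>Symmetry of \<open>A\<close> is applied to the graph elements over the two resolvents;
  \<open>z\<close> leaves the first slot as \<open>cnj z\<close>, so the terms carrying it
  cancel.\<close>

lemma resolvent_adjoint:
  assumes A: "self_adjoint A" and z: "z \<in> resolvent_set A" and zc: "cnj z \<in> resolvent_set A"
  shows "cinner (resolvent A z f) g = cinner f (resolvent A (cnj z) g)"
  using self_adjoint_symmetric[OF A resolvent_in[OF self_adjoint_linear_op[OF A] z, of f]
      resolvent_in[OF self_adjoint_linear_op[OF A] zc, of g]]
  by (simp add: cinner_diff_left cinner_diff_right cinner_scaleC_left cinner_scaleC_right)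

text \<open>The Hilbert adjoint \<open>R'\<close> of the resolvent at \<open>z\<close> is the
  resolvent at \<open>cnj z\<close>. Symmetry leaves \<open>R' f\<close> as the only possible
  solution; that the adjoint of \<open>A\<close> is no larger than \<open>A\<close> puts
  \<open>R' f\<close> into the domain.\<close>

lemma cnj_resolvent_set:
  assumes A: "self_adjoint A" and z: "z \<in> resolvent_set A"
  shows "cnj z \<in> resolvent_set A"
proof -
  note lin = self_adjoint_linear_op[OF A]
  obtain R' where R': "bounded_clinear R'" "\<And>x u. cinner (R' x) u = cinner x (resolvent A z u)"
    using hilbert_adjoint_exists[OF resolvent_clinear[OF z]] by blast
  have "(u, cnj z *\<^sub>C u - f) \<in> A \<longleftrightarrow> u = R' f" for u f
  proof
    assume uf: "(u, cnj z *\<^sub>C u - f) \<in> A"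
    show "u = R' f"
    proof (rule cinner_extensionality)
      fix x
      have "cinner u (z *\<^sub>C resolvent A z x - x) = cinner (cnj z *\<^sub>C u - f) (resolvent A z x)"
        by (rule self_adjoint_symmetric[OF A uf resolvent_in[OF lin z]])
      then show "cinner u x = cinner (R' f) x"
        by (simp add: R'(2) cinner_diff_left cinner_diff_right cinner_scaleC_left cinner_scaleC_right)
    qed
  next
    assume u: "u = R' f"
    show "(u, cnj z *\<^sub>C u - f) \<in> A"
    proof (rule self_adjoint_memI[OF A])
      fix a b assume "(a, b) \<in> A"
      then have "cinner u (z *\<^sub>C a - b) = cinner f a"
        by (simp add: u R'(2) resolvent_eq[OF lin z])
      then show "cinner u b = cinner (cnj z *\<^sub>C u - f) a"
        by (simp add: cinner_diff_left cinner_diff_right cinner_scaleC_left cinner_scaleC_right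
            algebra_simps)
    qed
  qed
  then show ?thesis using resolventI[OF lin R'(1)] by blast
qed

text \<open>The adjoint relation and the dense ranges make every \<open>R z\<close> injective, and the resolvent identity
  makes the operator \<open>z - (R z)\<inverse>\<close> independent of \<open>z\<close>.\<close>

lemma self_adjoint_of_pseudo_resolvent:
  fixes R :: "complex \<Rightarrow> 'h::complex_hilbert_space \<Rightarrow> 'h"
  assumes "Z \<noteq> {}"
    and cnjZ: "\<And>z. z \<in> Z \<Longrightarrow> cnj z \<in> Z"
    and R: "\<And>z. z \<in> Z \<Longrightarrow> bounded_clinear (R z)"
    and ident: "\<And>z w f. z \<in> Z \<Longrightarrow> w \<in> Z \<Longrightarrow> R w (f + (w - z) *\<^sub>C R z f) = R z f"
    and adj: "\<And>z f g. z \<in> Z \<Longrightarrow> cinner (R z f) g = cinner f (R (cnj z) g)"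
    and dense: "\<And>z. z \<in> Z \<Longrightarrow> closure (range (R z)) = UNIV"
  obtains A where "self_adjoint A" "Z \<subseteq> resolvent_set A" "\<forall>z\<in>Z. resolvent A z = R z"
proof -
  \<comment> \<open>This is \<open>z - (R z)\<inverse>\<close>, parametrised by \<open>f\<close> so
    that it makes sense before \<open>R z\<close> is known to be injective.\<close>
  define A where "A z = {(R z f, z *\<^sub>C R z f - f) |f. True}" for z
  have sub: "A z \<subseteq> A w" if "z \<in> Z" "w \<in> Z" for z w
  proof
    fix p assume "p \<in> A z"
    then obtain f where p: "p = (R z f, z *\<^sub>C R z f - f)" by (auto simp: A_def)
    let ?f = "f + (w - z) *\<^sub>C R z f"
    have "p = (R w ?f, w *\<^sub>C R w ?f - ?f)"
      unfolding p ident[OF that] by (simp add: complex_scale.scale_left_diff_distrib)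
    then show "p \<in> A w" unfolding A_def by blast
  qed
  then have eq: "A z = A w" if "z \<in> Z" "w \<in> Z" for z w using that by blast
  obtain z0 where z0: "z0 \<in> Z" using \<open>Z \<noteq> {}\<close> by blast
  \<comment> \<open>By \<open>adj\<close>, the kernel of \<open>R z\<close> is orthogonal to the
    dense range of \<open>R (cnj z)\<close>.\<close>
  have inj: "f = 0" if "R z f = 0" "z \<in> Z" for z f
  proof (rule cinner_eq_zero_dense[OF dense[OF cnjZ[OF that(2)]]])
    show "cinner f v = 0" if v: "v \<in> range (R (cnj z))" for v
      using v adj[OF \<open>z \<in> Z\<close>, of f] by (auto simp: \<open>R z f = 0\<close>)
  qed
  have mem: "(u, z *\<^sub>C u - f) \<in> A z \<longleftrightarrow> u = R z f" if "z \<in> Z" for z u f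
    unfolding A_def by auto
  have memE: "\<exists>f. u = R z0 f \<and> v = z0 *\<^sub>C u - f" if "(u, v) \<in> A z0" for u v
    using that unfolding A_def by auto
  have lin: "linear_op (A z0)"
    unfolding linear_op_def
  proof (intro conjI allI impI)
    show "single_valued (A z0)"
    proof (rule single_valuedI)
      fix u v v' assume "(u, v) \<in> A z0" "(u, v') \<in> A z0"
      then obtain f f' where f: "u = R z0 f" "v = z0 *\<^sub>C u - f"
        and f': "u = R z0 f'" "v' = z0 *\<^sub>C u - f'"
        by (blast dest!: memE)
      have "R z0 (f - f') = 0"
        unfolding bounded_clinear_diff[OF R[OF z0]] f(1)[symmetric] f'(1)[symmetric] by simp
      then have "f - f' = 0" using z0 by (rule inj)
      then show "v = v'" unfolding f(2) f'(2) by simp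
    qed
    show "(0, 0) \<in> A z0"
      using mem[OF z0, of 0 0] by (simp add: bounded_clinear_zero[OF R[OF z0]])
    show "(x + x', y + y') \<in> A z0" if xy: "(x, y) \<in> A z0" "(x', y') \<in> A z0" for x y x' y'
    proof -
      from xy obtain f f' where f: "x = R z0 f" "y = z0 *\<^sub>C x - f"
        and f': "x' = R z0 f'" "y' = z0 *\<^sub>C x' - f'"
        by (blast dest!: memE)
      have "(x + x', z0 *\<^sub>C (x + x') - (f + f')) \<in> A z0"
        unfolding mem[OF z0] bounded_clinear_add[OF R[OF z0]] f(1) f'(1) ..
      then show ?thesis unfolding f(2) f'(2) scaleC_add_right by (simp add: algebra_simps)
    qed
    show "(c *\<^sub>C x, c *\<^sub>C y) \<in> A z0" if xy: "(x, y) \<in> A z0" for c x y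
    proof -
      from xy obtain f where f: "x = R z0 f" "y = z0 *\<^sub>C x - f"
        by (blast dest!: memE)
      have "(c *\<^sub>C x, z0 *\<^sub>C c *\<^sub>C x - c *\<^sub>C f) \<in> A z0"
        unfolding mem[OF z0] bounded_clinear_scaleC[OF R[OF z0]] f(1) ..
      then show ?thesis
        unfolding f(2) complex_scale.scale_right_diff_distrib by (simp add: mult.commute)
    qed
  qed
  \<comment> \<open>Solving the adjoint relation for \<open>\<eta>\<close> yields the graph built at
    \<open>cnj z0\<close>, which is \<open>A z0\<close> again by independence of the point.\<close>
  have "op_adjoint cinner cinner (A z0) = A (cnj z0)"
  proof (rule set_eqI, clarify)
    fix \<eta> \<xi> :: 'h
    let ?f = "cnj z0 *\<^sub>C \<eta> - \<xi>"
    have "(\<eta>, \<xi>) \<in> op_adjoint cinner cinner (A z0) \<longleftrightarrow>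
        (\<forall>f. cinner \<eta> (z0 *\<^sub>C R z0 f - f) = cinner \<xi> (R z0 f))"
      unfolding op_adjoint_def A_def by blast
    also have "\<dots> \<longleftrightarrow> (\<forall>f. cinner \<eta> f = cinner ?f (R z0 f))"
      unfolding cinner_diff_left cinner_diff_right cinner_scaleC_left cinner_scaleC_right
        complex_cnj_cnj
      by (intro iff_allI) (auto simp only: diff_eq_eq eq_diff_eq add.commute)
    also have "\<dots> \<longleftrightarrow> (\<forall>f. cinner \<eta> f = cinner (R (cnj z0) ?f) f)"
      by (simp add: adj[OF cnjZ[OF z0]])
    also have "\<dots> \<longleftrightarrow> \<eta> = R (cnj z0) ?f"
      by (auto intro: cinner_extensionality)
    also have "\<dots> \<longleftrightarrow> (\<eta>, \<xi>) \<in> A (cnj z0)" using mem[OF cnjZ[OF z0], of \<eta> ?f] by simp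
    finally show "(\<eta>, \<xi>) \<in> op_adjoint cinner cinner (A z0) \<longleftrightarrow> (\<eta>, \<xi>) \<in> A (cnj z0)" .
  qed
  moreover have "Domain (A z0) = range (R z0)" by (auto simp: A_def)
  ultimately have "self_adjoint (A z0)"
    unfolding self_adjoint_def using lin dense[OF z0] eq[OF cnjZ[OF z0] z0] by simp
  moreover have "z \<in> resolvent_set (A z0) \<and> resolvent (A z0) z = R z" if "z \<in> Z" for z
    by (rule resolventI[OF lin R[OF that]]) (use mem[OF that] eq[OF that z0] in simp)
  ultimately show thesis using that by blast
qed

text \<open>With \<open>P = 1 + c R0z\<close> and \<open>P' = 1 + c Rz\<close>, the resolvent identities give
  \<open>P\<inverse> = 1 - c R0w\<close> and \<open>P'\<inverse> = 1 - c Rw = P\<inverse> - c U L T\<close>; so this is Woodbury's formula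
  \<open>(L\<inverse> - c T P U)\<inverse> = L + c L T P' U L\<close> for an unbounded \<open>M = L\<inverse>\<close>.\<close>

lemma inverse_of_perturbed_operator:
  fixes M :: "('y::complex_normed_space \<times> 'x::complex_normed_space) set"
    and T :: "'h::complex_normed_space \<Rightarrow> 'x"
  assumes T: "bounded_clinear T" and U: "bounded_clinear U" and L: "bounded_clinear L"
    and M: "\<And>y x. (y, x) \<in> M \<longleftrightarrow> y = L x"
    and Rw: "\<And>f. Rw f = R0w f + U (L (T f))"
    and R: "\<And>f. Rw (f + c *\<^sub>C Rz f) = Rz f" "\<And>f. Rz (f - c *\<^sub>C Rw f) = Rw f"
    and R0: "\<And>f. R0w (f + c *\<^sub>C R0z f) = R0z f" "\<And>f. R0z (f - c *\<^sub>C R0w f) = R0w f"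
  shows "(\<exists>x'. (y, x') \<in> M \<and> x = x' - c *\<^sub>C T (U y + c *\<^sub>C R0z (U y))) \<longleftrightarrow>
    y = L x + c *\<^sub>C L (T (U (L x) + c *\<^sub>C Rz (U (L x))))"
    (is "?lhs \<longleftrightarrow> ?rhs")
proof -
  note simps = bounded_clinear_simps[OF T] bounded_clinear_simps[OF U] bounded_clinear_simps[OF L]
    complex_scale.scale_right_diff_distrib scaleC_add_right
  have ULT: "U (L (T f)) = Rw f - R0w f" for f by (simp add: Rw)
  show ?thesis
  proof
    assume ?lhs
    then obtain x' where y: "y = L x'" and x: "x = x' - c *\<^sub>C T (U y + c *\<^sub>C R0z (U y))"
      using M by blast
    \<comment> \<open>Here \<open>p = P U y\<close>. It also equals \<open>P' U L x\<close>, because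
      replacing \<open>U L T\<close> by \<open>Rw - R0w\<close> gives
      \<open>U L x = p - c Rw p\<close>.\<close>
    define p where "p = U y + c *\<^sub>C R0z (U y)"
    have p: "U y = p - c *\<^sub>C R0w p" unfolding p_def R0(1) by simp
    have Lx: "L x = y - c *\<^sub>C L (T p)" by (simp add: x y p_def simps)
    then have "U (L x) = U y - c *\<^sub>C U (L (T p))" by (simp add: simps)
    then have "U (L x) = p - c *\<^sub>C Rw p" by (simp add: ULT p simps)
    then have "U (L x) + c *\<^sub>C Rz (U (L x)) = p" by (simp add: R(2))
    then show ?rhs by (simp add: Lx)
  next
    assume y: ?rhs
    \<comment> \<open>Conversely \<open>q = P' U L x\<close> is shown to equal \<open>P U y\<close>,
      so \<open>x + c T q\<close> is the witness for \<open>x'\<close>.\<close>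
    define q where "q = U (L x) + c *\<^sub>C Rz (U (L x))"
    have q: "U (L x) = q - c *\<^sub>C Rw q" unfolding q_def R(1) by simp
    have "y = L (x + c *\<^sub>C T q)" by (simp add: y q_def simps)
    then have mem: "(y, x + c *\<^sub>C T q) \<in> M" by (simp add: M)
    have "y = L x + c *\<^sub>C L (T q)" by (simp add: y q_def)
    then have "U y = U (L x) + c *\<^sub>C U (L (T q))" by (simp add: simps)
    then have "U y = q - c *\<^sub>C R0w q" by (simp add: ULT q simps)
    then have "U y + c *\<^sub>C R0z (U y) = q" by (simp add: R0(2))
    then show ?lhs using mem by (intro exI[of _ "x + c *\<^sub>C T q"]) simp
  qed
qed

section \<open>The operators \<open>G\<close>\<close>

text \<open>Continuity of \<open>\<tau>\<close> is available only in the graph norm, so the map is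
  factored through the graph of \<open>A0\<close>, into which the resolvent lifts
  continuously.\<close>

lemma bounded_clinear_trace_resolvent:
  assumes A0: "linear_op A0" and \<tau>: "trace_map A0 \<tau>" and z: "z \<in> resolvent_set A0"
  shows "bounded_clinear (\<lambda>u. \<tau> (resolvent A0 z u))"
proof (rule bounded_clinear_of_continuous)
  note R = resolvent_clinear[OF z]
  have dom: "resolvent A0 z u \<in> Domain A0" for u
    using resolvent_in[OF A0 z] by blast
  show "\<tau> (resolvent A0 z (x + y)) = \<tau> (resolvent A0 z x) + \<tau> (resolvent A0 z y)" for x y
    using \<tau> dom unfolding trace_map_def bounded_clinear_add[OF R] by blast
  show "\<tau> (resolvent A0 z (c *\<^sub>C x)) = c *\<^sub>C \<tau> (resolvent A0 z x)" for c x
    using \<tau> dom unfolding trace_map_def bounded_clinear_scaleC[OF R] by blast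
  have "continuous_on UNIV ((\<lambda>(u, v). \<tau> u) \<circ>
      (\<lambda>u. (resolvent A0 z u, z *\<^sub>C resolvent A0 z u - u)))"
  proof (rule continuous_on_compose)
    show "continuous_on UNIV (\<lambda>u. (resolvent A0 z u, z *\<^sub>C resolvent A0 z u - u))"
      by (intro continuous_on_Pair linear_continuous_on bounded_clinear_imp_bounded_linear
          R bounded_clinear_minus bounded_clinear_scale bounded_clinear_ident)
    show "continuous_on (range (\<lambda>u. (resolvent A0 z u, z *\<^sub>C resolvent A0 z u - u))) (\<lambda>(u, v). \<tau> u)"
    proof (rule continuous_on_subset)
      show "continuous_on A0 (\<lambda>(u, v). \<tau> u)" using \<tau> by (simp add: trace_map_def)
    qed (auto simp: resolvent_in[OF A0 z])
  qed
  then show "continuous_on UNIV (\<lambda>u. \<tau> (resolvent A0 z u))" by (simp add: o_def)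
qed

text \<open>Riesz supplies a vector satisfying the adjoint relation, hence the one that
  \<open>G_op\<close> denotes. The properties of \<open>G_op\<close> are derived from this
  identity.\<close>

lemma cinner_G_op:
  assumes A0: "self_adjoint A0" and \<tau>: "trace_map A0 \<tau>" and z: "z \<in> resolvent_set A0"
  shows "cinner (G_op A0 \<tau> z \<psi>) u = dual_apply \<psi> (\<tau> (resolvent A0 (cnj z) u))"
proof -
  have "bounded_clinear (\<lambda>u. dual_apply \<psi> (\<tau> (resolvent A0 (cnj z) u)))"
    by (intro bounded_clinear_compose[OF bounded_clinear_dual_apply]
        bounded_clinear_trace_resolvent[OF self_adjoint_linear_op[OF A0] \<tau> cnj_resolvent_set[OF A0 z]])
  then obtain g where g: "\<And>u. cinner g u = dual_apply \<psi> (\<tau> (resolvent A0 (cnj z) u))"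
    by (rule riesz_representation) blast
  have "G_op A0 \<tau> z \<psi> = g"
    unfolding G_op_def
    by (rule adjoint_fun_eqI) (auto simp: pairing_eq_dual_apply g intro: cinner_extensionality)
  then show ?thesis using g by simp
qed

text \<open>The adjoint is taken twice, which returns the original map since K** = K:
  \<open>copairing\<close> undoes the conjugation, and functionals separate the points of K.\<close>

lemma G_adj_eq:
  assumes A0: "self_adjoint A0" and \<tau>: "trace_map A0 \<tau>" and z: "z \<in> resolvent_set A0"
  shows "G_adj A0 \<tau> (cnj z) u = \<tau> (resolvent A0 z u)"
  unfolding G_adj_def
proof (rule adjoint_fun_eqI)
  show "cinner u (G_op A0 \<tau> (cnj z) \<psi>) = copairing (\<tau> (resolvent A0 z u)) \<psi>" for \<psi>
    using cinner_G_op[OF A0 \<tau> cnj_resolvent_set[OF A0 z], of \<psi> u]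
    by (simp add: copairing_def pairing_eq_dual_apply cinner_commute[of u])
  show "x = y" if "\<And>\<psi>. copairing x \<psi> = copairing y \<psi>" for x y :: 'b
    by (rule dual_apply_eq_imp_eq) (use that in \<open>simp add: copairing_def pairing_eq_dual_apply\<close>)
qed

lemma bounded_clinear_G_op:
  assumes A0: "self_adjoint A0" and \<tau>: "trace_map A0 \<tau>" and z: "z \<in> resolvent_set A0"
  shows "bounded_clinear (G_op A0 \<tau> z)"
proof -
  note G = cinner_G_op[OF A0 \<tau> z]
  obtain K where K: "0 \<le> K" "\<And>u. norm (\<tau> (resolvent A0 (cnj z) u)) \<le> norm u * K"
    using bounded_linear.nonneg_bounded[OF bounded_clinear_imp_bounded_linear[OF
          bounded_clinear_trace_resolvent[OF self_adjoint_linear_op[OF A0] \<tau> cnj_resolvent_set[OF A0 z]]]]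
    by blast
  show ?thesis
  proof (rule bounded_clinearI)
    show "G_op A0 \<tau> z (\<psi> + \<phi>) = G_op A0 \<tau> z \<psi> + G_op A0 \<tau> z \<phi>" for \<psi> \<phi>
      by (rule cinner_extensionality) (simp add: G cinner_add_left dual_apply_add)
    show "G_op A0 \<tau> z (c *\<^sub>C \<psi>) = c *\<^sub>C G_op A0 \<tau> z \<psi>" for c \<psi>
      by (rule cinner_extensionality) (simp add: G cinner_scaleC_left dual_apply_scaleC)
    show "norm (G_op A0 \<tau> z \<psi>) \<le> norm \<psi> * K" for \<psi>
    proof (cases "G_op A0 \<tau> z \<psi> = 0")
      case True
      then show ?thesis using K(1) by simp
    next
      case False
      let ?g = "G_op A0 \<tau> z \<psi>"
      have "norm ?g * norm ?g = cmod (cinner ?g ?g)"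
        by (simp add: cinner_self power2_eq_square norm_mult)
      also have "\<dots> \<le> norm \<psi> * norm (\<tau> (resolvent A0 (cnj z) ?g))"
        unfolding G by (rule norm_dual_apply)
      also have "\<dots> \<le> norm \<psi> * (norm ?g * K)" by (intro mult_left_mono K(2)) simp
      finally have "norm ?g * norm ?g \<le> norm ?g * (norm \<psi> * K)" by (simp add: mult_ac)
      then show ?thesis using False by simp
    qed
  qed
qed

text \<open>This is the adjoint of the resolvent identity at the conjugate points with
  \<open>\<tau>\<close> applied: tested against \<open>u\<close>, the resolvent at \<open>z\<close>
  moves over as the one at \<open>cnj z\<close>.\<close>

lemma G_op_identity:
  assumes A0: "self_adjoint A0" and \<tau>: "trace_map A0 \<tau>"
    and z: "z \<in> resolvent_set A0" and w: "w \<in> resolvent_set A0"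
  shows "G_op A0 \<tau> z \<psi> = G_op A0 \<tau> w \<psi> + (w - z) *\<^sub>C resolvent A0 z (G_op A0 \<tau> w \<psi>)"
proof (rule cinner_extensionality)
  fix u
  note zc = cnj_resolvent_set[OF A0 z] and wc = cnj_resolvent_set[OF A0 w]
  have "cinner (G_op A0 \<tau> w \<psi> + (w - z) *\<^sub>C resolvent A0 z (G_op A0 \<tau> w \<psi>)) u
      = cinner (G_op A0 \<tau> w \<psi>) (u + (cnj w - cnj z) *\<^sub>C resolvent A0 (cnj z) u)"
    by (simp add: cinner_add_left cinner_add_right cinner_scaleC_left cinner_scaleC_right
        resolvent_adjoint[OF A0 z zc])
  also have "\<dots> = cinner (G_op A0 \<tau> z \<psi>) u"
    unfolding cinner_G_op[OF A0 \<tau> w] cinner_G_op[OF A0 \<tau> z]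
      resolvent_identity[OF self_adjoint_linear_op[OF A0] zc wc] ..
  finally show "cinner (G_op A0 \<tau> z \<psi>) u
      = cinner (G_op A0 \<tau> w \<psi> + (w - z) *\<^sub>C resolvent A0 z (G_op A0 \<tau> w \<psi>)) u" by simp
qed

lemma G_op_identity':
  assumes A0: "self_adjoint A0" and \<tau>: "trace_map A0 \<tau>"
    and z: "z \<in> resolvent_set A0" and w: "w \<in> resolvent_set A0"
  shows "(w - z) *\<^sub>C resolvent A0 w (G_op A0 \<tau> z \<psi>) = G_op A0 \<tau> z \<psi> - G_op A0 \<tau> w \<psi>"
  using G_op_identity[OF A0 \<tau> w z, of \<psi>]
  by (simp add: complex_scale.scale_left_diff_distrib algebra_simps)

section \<open>The extension \<open>A\<^sub>\<Lambda>\<close>\<close>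

text \<open>The conditions on \<open>\<Lambda>\<close> are stated with \<open>G(cnj w)* = \<tau> R\<^sub>w\<close>, and the adjoints are spelled out
  as the pairing of the images in \<open>K*\<close> with elements of \<open>K\<close>.\<close>

lemma A_Lambda_properties:
  fixes A0 :: "('h::complex_hilbert_space \<times> 'h) set" and \<tau> :: "'h \<Rightarrow> 'k::complex_hilbert_space"
    and V :: "'k \<Rightarrow> 'x::complex_hilbert_space" and W :: "'y::complex_hilbert_space \<Rightarrow> 'k dual"
    and L :: "complex \<Rightarrow> 'x \<Rightarrow> 'y"
  assumes A0: "self_adjoint A0" and \<tau>: "trace_map A0 \<tau>"
    and V: "bounded_clinear V" and W: "bounded_clinear W"
    and Z: "Z \<noteq> {}" "Z \<subseteq> resolvent_set A0" and cnjZ: "\<And>z. z \<in> Z \<Longrightarrow> cnj z \<in> Z"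
    and L: "\<And>z. z \<in> Z \<Longrightarrow> bounded_clinear (L z)"
    and L_adj: "\<And>z \<phi> \<phi>'. z \<in> Z \<Longrightarrow>
      dual_apply (W (L (cnj z) (V \<phi>))) \<phi>' = cnj (dual_apply (W (L z (V \<phi>'))) \<phi>)"
    and L_ident: "\<And>z w x. z \<in> Z \<Longrightarrow> w \<in> Z \<Longrightarrow>
      L z x = L w (x + (w - z) *\<^sub>C V (\<tau> (resolvent A0 w (G_op A0 \<tau> z (W (L z x))))))"
  shows "self_adjoint (A_Lambda A0 \<tau> V W Z L)" (is ?sa)
    and "Z \<subseteq> resolvent_set (A_Lambda A0 \<tau> V W Z L)" (is ?sub)
    and "\<And>z u. z \<in> Z \<Longrightarrow> resolvent (A_Lambda A0 \<tau> V W Z L) z u =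
      resolvent A0 z u + G_op A0 \<tau> z (W (L z (V (\<tau> (resolvent A0 z u)))))"
proof -
  note lin = self_adjoint_linear_op[OF A0]
  have \<rho>: "z \<in> resolvent_set A0" if "z \<in> Z" for z using Z(2) that by blast
  define R where "R z u = resolvent A0 z u + G_op A0 \<tau> z (W (L z (V (\<tau> (resolvent A0 z u)))))"
    for z u
  have R: "bounded_clinear (R z)" if z: "z \<in> Z" for z
  proof -
    have "bounded_clinear (\<lambda>u. G_op A0 \<tau> z (W (L z (V (\<tau> (resolvent A0 z u))))))"
      by (intro bounded_clinear_compose[OF bounded_clinear_G_op[OF A0 \<tau> \<rho>[OF z]]]
          bounded_clinear_compose[OF W] bounded_clinear_compose[OF L[OF z]]
          bounded_clinear_compose[OF V] bounded_clinear_trace_resolvent[OF lin \<tau> \<rho>[OF z]])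
    then show ?thesis
      using bounded_clinear_plus[OF resolvent_clinear[OF \<rho>[OF z]]]
      unfolding R_def[abs_def] by blast
  qed
  \<comment> \<open>The correction term sees only \<open>\<tau> u\<close>, so it vanishes on the
    kernel. This gives both the dense range of \<open>R z\<close> and, later, the extension property
    of \<open>A\<close>.\<close>
  have \<tau>0: "R z (z *\<^sub>C u - v) = u" if "z \<in> Z" "(u, v) \<in> A0" "\<tau> u = 0" for z u v
    unfolding R_def resolvent_eq[OF lin \<rho>[OF that(1)] that(2)] \<open>\<tau> u = 0\<close>
      bounded_clinear_zero[OF V] bounded_clinear_zero[OF L[OF that(1)]] bounded_clinear_zero[OF W]
      bounded_clinear_zero[OF bounded_clinear_G_op[OF A0 \<tau> \<rho>[OF that(1)]]]
    by simp
  have dense: "closure (range (R z)) = UNIV" if z: "z \<in> Z" for z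
  proof -
    have "{u \<in> Domain A0. \<tau> u = 0} \<subseteq> range (R z)"
      by (auto intro: range_eqI[where f="R z", OF \<tau>0[OF z, symmetric]])
    then have "closure {u \<in> Domain A0. \<tau> u = 0} \<subseteq> closure (range (R z))"
      by (rule closure_mono)
    then show ?thesis using \<tau> by (auto simp: trace_map_def)
  qed
  have ident: "R w (f + (w - z) *\<^sub>C R z f) = R z f" if z: "z \<in> Z" and w: "w \<in> Z" for z w f
  proof -
    define r where "r = resolvent A0 z f"
    define b where "b = L z (V (\<tau> r))"
    define g where "g = G_op A0 \<tau> z (W b)"
    note \<tau>R = bounded_clinear_trace_resolvent[OF lin \<tau> \<rho>[OF w]]
    have arg: "f + (w - z) *\<^sub>C R z f = (f + (w - z) *\<^sub>C r) + (w - z) *\<^sub>C g"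
      by (simp add: R_def r_def b_def g_def scaleC_add_right)
    have r: "resolvent A0 w (f + (w - z) *\<^sub>C r) = r"
      unfolding r_def by (rule resolvent_identity[OF lin \<rho>[OF z] \<rho>[OF w]])
    have res: "resolvent A0 w (f + (w - z) *\<^sub>C R z f) = r + (w - z) *\<^sub>C resolvent A0 w g"
      using bounded_clinear_add[OF resolvent_clinear[OF \<rho>[OF w]], of "f + (w - z) *\<^sub>C r" "(w - z) *\<^sub>C g"]
      unfolding arg r bounded_clinear_scaleC[OF resolvent_clinear[OF \<rho>[OF w]]] .
    have "\<tau> (resolvent A0 w (f + (w - z) *\<^sub>C R z f)) = \<tau> r + (w - z) *\<^sub>C \<tau> (resolvent A0 w g)"
      using bounded_clinear_add[OF \<tau>R, of "f + (w - z) *\<^sub>C r" "(w - z) *\<^sub>C g"]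
      unfolding arg r bounded_clinear_scaleC[OF \<tau>R] .
    then have "V (\<tau> (resolvent A0 w (f + (w - z) *\<^sub>C R z f)))
        = V (\<tau> r) + (w - z) *\<^sub>C V (\<tau> (resolvent A0 w g))"
      by (simp add: bounded_clinear_add[OF V] bounded_clinear_scaleC[OF V])
    \<comment> \<open>\<open>L_ident\<close> at \<open>x = V (\<tau> r)\<close> absorbs the change
      of the argument, so \<open>b\<close> comes back.\<close>
    then have "L w (V (\<tau> (resolvent A0 w (f + (w - z) *\<^sub>C R z f)))) = b"
      using L_ident[OF z w, of "V (\<tau> r)"] by (simp add: b_def g_def)
    then have "R w (f + (w - z) *\<^sub>C R z f) = r + (w - z) *\<^sub>C resolvent A0 w g + G_op A0 \<tau> w (W b)"
      unfolding R_def[of w] res by simp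
    \<comment> \<open>The term with the resolvent at \<open>w\<close> equals
      \<open>g - G_op A0 \<tau> w (W b)\<close>, and the subtracted part cancels the last
      summand.\<close>
    also have "\<dots> = r + g"
      unfolding g_def G_op_identity'[OF A0 \<tau> \<rho>[OF z] \<rho>[OF w]] by simp
    finally show ?thesis by (simp add: R_def[of z f] r_def b_def g_def)
  qed
  \<comment> \<open>The unperturbed parts are adjoint to each other; in the correction terms
    \<open>L_adj\<close> exchanges the roles of \<open>f\<close> and \<open>g\<close>.\<close>
  have adj: "cinner (R z f) g = cinner f (R (cnj z) g)" if z: "z \<in> Z" for z f g
  proof -
    note zc = cnjZ[OF z]
    have "cinner f (G_op A0 \<tau> (cnj z) (W (L (cnj z) (V (\<tau> (resolvent A0 (cnj z) g))))))
        = cnj (dual_apply (W (L (cnj z) (V (\<tau> (resolvent A0 (cnj z) g))))) (\<tau> (resolvent A0 z f)))"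
      using cinner_G_op[OF A0 \<tau> \<rho>[OF zc]] by (simp add: cinner_commute[of f])
    also have "\<dots> = dual_apply (W (L z (V (\<tau> (resolvent A0 z f))))) (\<tau> (resolvent A0 (cnj z) g))"
      by (simp add: L_adj[OF z])
    finally show ?thesis
      by (simp add: R_def cinner_add_left cinner_add_right cinner_G_op[OF A0 \<tau> \<rho>[OF z]]
          resolvent_adjoint[OF A0 \<rho>[OF z] \<rho>[OF zc]])
  qed
  obtain A where A: "self_adjoint A" "Z \<subseteq> resolvent_set A" and A_R: "\<forall>z\<in>Z. resolvent A z = R z"
    by (rule self_adjoint_of_pseudo_resolvent[where R=R, OF Z(1) cnjZ R ident adj dense]) blast
  obtain z0 where z0: "z0 \<in> Z" using Z(1) by blast
  have G: "G_adj A0 \<tau> (cnj z) u = \<tau> (resolvent A0 z u)" if "z \<in> Z" for z u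
    by (rule G_adj_eq[OF A0 \<tau> \<rho>[OF that]])
  let ?P = "\<lambda>A. self_adjoint A \<and> {(u, v) \<in> A0. \<tau> u = 0} \<subseteq> A \<and>
     Z \<subseteq> resolvent_set A0 \<inter> resolvent_set A \<and>
     (\<forall>z\<in>Z. \<forall>u. resolvent A z u =
        resolvent A0 z u + G_op A0 \<tau> z (W (L z (V (G_adj A0 \<tau> (cnj z) u)))))"
  have PA: "?P A"
  proof (intro conjI ballI allI)
    show "{(u, v) \<in> A0. \<tau> u = 0} \<subseteq> A"
    proof clarify
      fix u v assume uv: "(u, v) \<in> A0" "\<tau> u = 0"
      have "(u, z0 *\<^sub>C u - (z0 *\<^sub>C u - v)) \<in> A"
        using resolvent_iff[OF self_adjoint_linear_op[OF A(1)], of z0 u "z0 *\<^sub>C u - v"] z0 A(2) A_R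
          \<tau>0[OF z0 uv] by auto
      then show "(u, v) \<in> A" by simp
    qed
  qed (use A A_R Z(2) in \<open>auto simp: G R_def\<close>)
  \<comment> \<open>The resolvent at the single point \<open>z0\<close> determines the graph:
    \<open>(u, v)\<close> lies in it iff \<open>z0 *\<^sub>C u - v\<close> is mapped to
    \<open>u\<close>.\<close>
  have "B = A" if PB: "?P B" for B
  proof (rule set_eqI, clarify)
    fix u v
    have z0B: "z0 \<in> resolvent_set B" "resolvent B z0 f = R z0 f" for f
      using PB z0 by (auto simp: G R_def)
    have "(u, z0 *\<^sub>C u - (z0 *\<^sub>C u - v)) \<in> B \<longleftrightarrow> (u, z0 *\<^sub>C u - (z0 *\<^sub>C u - v)) \<in> A"
      using resolvent_iff[OF self_adjoint_linear_op z0B(1), of u "z0 *\<^sub>C u - v"] PB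
        resolvent_iff[OF self_adjoint_linear_op[OF A(1)], of z0 u "z0 *\<^sub>C u - v"] z0 A(2) A_R
        z0B(2) by auto
    then show "(u, v) \<in> B \<longleftrightarrow> (u, v) \<in> A" by simp
  qed
  then have eq: "A_Lambda A0 \<tau> V W Z L = A"
    unfolding A_Lambda_def using PA by (intro the_equality) blast+
  show ?sa ?sub using A eq by auto
  show "resolvent (A_Lambda A0 \<tau> V W Z L) z u =
      resolvent A0 z u + G_op A0 \<tau> z (W (L z (V (\<tau> (resolvent A0 z u)))))" if "z \<in> Z" for z u
    using A_R that eq by (simp add: R_def)
qed

section \<open>The operator \<open>A_Q\<close>\<close>

text \<open>A pair lies in the adjoint graph iff \<open>\<eta>' = \<xi>' \<circ> L\<close>, so
  \<open>\<xi>'\<close> determines \<open>\<eta>'\<close>: the inverse of the adjoint is the adjoint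
  of the inverse.\<close>

lemma op_inv_op_adjoint_pairing:
  fixes T :: "('y::complex_hilbert_space \<times> 'x::complex_hilbert_space) set"
  assumes L: "bounded_clinear L" and T: "\<And>y x. (y, x) \<in> T \<longleftrightarrow> y = L x"
  shows "dual_apply (op_inv (op_adjoint pairing pairing T) \<xi>) x = dual_apply \<xi> (L x)"
proof -
  obtain \<eta> where \<eta>: "\<And>x. dual_apply \<eta> x = dual_apply \<xi> (L x)"
    using bounded_clinear_functional_imp_dual[OF bounded_clinear_compose[OF bounded_clinear_dual_apply L]]
    by metis
  have iff: "(\<eta>', \<xi>') \<in> op_adjoint pairing pairing T \<longleftrightarrow>
      (\<forall>x. dual_apply \<eta>' x = dual_apply \<xi>' (L x))" for \<eta>' \<xi>'
    by (auto simp: op_adjoint_def T pairing_eq_dual_apply)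
  have "op_inv (op_adjoint pairing pairing T) \<xi> = \<eta>"
    unfolding op_inv_def
  proof (rule op_app_eqI)
    show "single_valued ((op_adjoint pairing pairing T)\<inverse>)"
      by (rule single_valuedI) (simp add: iff dual_eqI)
  qed (simp add: iff \<eta>)
  then show ?thesis by (simp add: \<eta>)
qed

lemma dual_apply_adjoint_pairing:
  fixes V :: "'k::complex_hilbert_space \<Rightarrow> 'x::complex_hilbert_space"
  assumes V: "bounded_clinear V"
  shows "dual_apply (adjoint_fun pairing pairing V \<eta>) \<phi> = dual_apply \<eta> (V \<phi>)"
proof -
  obtain \<xi> where \<xi>: "\<And>x. dual_apply \<xi> x = dual_apply \<eta> (V x)"
    using bounded_clinear_functional_imp_dual[OF bounded_clinear_compose[OF bounded_clinear_dual_apply V]]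
    by metis
  have "adjoint_fun pairing pairing V \<eta> = \<xi>"
    by (rule adjoint_fun_eqI) (simp_all add: pairing_eq_dual_apply \<xi> dual_eqI)
  then show ?thesis by (simp add: \<xi>)
qed

text \<open>The adjoint of \<open>W\<close> starts from K** = K, where \<open>\<phi>\<close> acts on
  the dual by conjugated evaluation; hence the conjugate.\<close>

lemma dual_apply_adjoint_copairing:
  fixes W :: "'y::complex_hilbert_space \<Rightarrow> 'k::complex_hilbert_space dual"
  assumes W: "bounded_clinear W"
  shows "dual_apply (adjoint_fun pairing copairing W \<phi>) y = cnj (dual_apply (W y) \<phi>)"
proof -
  obtain \<xi> where \<xi>: "\<And>y. dual_apply \<xi> y = cnj (dual_apply (W y) \<phi>)"
    using bounded_clinear_functional_imp_dual[OF
        bounded_clinear_compose[OF bounded_clinear_cnj_dual_apply W]]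
    by metis
  have "adjoint_fun pairing copairing W \<phi> = \<xi>"
    by (rule adjoint_fun_eqI) (simp_all add: pairing_eq_dual_apply copairing_def \<xi> dual_eqI)
  then show ?thesis by (simp add: \<xi>)
qed

section \<open>Invertibility of \<open>Q z\<close> and the two resolvent sets\<close>

theorem theorem2p19:
  fixes A0 :: "('h::complex_hilbert_space \<times> 'h) set"
    and \<tau> :: "'h \<Rightarrow> 'k::complex_hilbert_space"
    and V :: "'k \<Rightarrow> 'x::complex_hilbert_space"
    and W :: "'y::complex_hilbert_space \<Rightarrow> 'k dual"
    and Q :: "complex \<Rightarrow> ('y \<times> 'x) set"
    and D :: "'y set"
  assumes "self_adjoint A0"
    and "trace_map A0 \<tau>"
    and "bounded_clinear V"
    and "bounded_clinear W"
    and "\<And>z. z \<in> resolvent_set A0 \<Longrightarrow> closed_op (Q z)"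
    and "\<And>z. z \<in> resolvent_set A0 \<Longrightarrow> Domain (Q z) = D"
    and "closure D = UNIV"
    and "\<And>z w. z \<in> resolvent_set A0 \<Longrightarrow> w \<in> resolvent_set A0 \<Longrightarrow>
           Q z = {(y, x + (z - w) *\<^sub>C V (G_adj A0 \<tau> (cnj w) (G_op A0 \<tau> z (W y)))) |y x.
                    (y, x) \<in> Q w}"
    and "\<And>z \<phi>. z \<in> Z_Q A0 Q \<Longrightarrow>
           adjoint_fun pairing pairing V
             (op_inv (op_adjoint pairing pairing (Q z)) (adjoint_fun pairing copairing W \<phi>)) =
           W (op_inv (Q (cnj z)) (V \<phi>))"
    and "Z_Q A0 Q \<noteq> {}"
  shows "Z_Q A0 Q = resolvent_set A0 \<inter> resolvent_set (A_Q A0 \<tau> V W Q) \<and>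
    (\<forall>z \<in> resolvent_set A0 \<inter> resolvent_set (A_Q A0 \<tau> V W Q).
       (\<forall>w \<in> Z_Q A0 Q. op_inv (Q z) = Lambda_hat A0 \<tau> V W Q w z) \<and>
       (\<forall>u. resolvent (A_Q A0 \<tau> V W Q) z u =
          resolvent A0 z u + G_op A0 \<tau> z (W (op_inv (Q z) (V (G_adj A0 \<tau> (cnj z) u))))))"
proof -
  note A0 = assms(1) and \<tau> = assms(2) and V = assms(3) and W = assms(4)
    and closed = assms(5) and Q = assms(8) and Q_adj = assms(9)
  note lin = self_adjoint_linear_op[OF A0]
  let ?Z = "Z_Q A0 Q" and ?A = "A_Q A0 \<tau> V W Q" and ?L = "\<lambda>z. op_inv (Q z)"
  have \<rho>: "z \<in> resolvent_set A0" if "z \<in> ?Z" for z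
    using that by (simp add: Z_Q_def)
  have cnjZ: "cnj z \<in> ?Z" if "z \<in> ?Z" for z
    using that cnj_resolvent_set[OF A0] by (simp add: Z_Q_def)
  have L: "bounded_clinear (?L z)" if "z \<in> ?Z" for z
    using that by (simp add: Z_Q_def boundedly_invertible_clinear)
  have sv: "single_valued (Q z)" if "z \<in> resolvent_set A0" for z
    using closed[OF that] by (simp add: closed_op_def linear_op_single_valued)
  have Q_iff: "(y, x) \<in> Q z \<longleftrightarrow> y = ?L z x" if "z \<in> ?Z" for z y x
    using boundedly_invertible_graph[OF sv[OF \<rho>[OF that]]] that by (simp add: Z_Q_def)
  \<comment> \<open>Condition (ii) as a perturbation of \<open>Q w\<close>, with the sign turned so
    that \<open>w - z\<close> becomes the constant \<open>c\<close> of Woodbury's formula.\<close>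
  have Q_mem: "(y, x) \<in> Q z \<longleftrightarrow>
      (\<exists>x'. (y, x') \<in> Q w \<and> x = x' - (w - z) *\<^sub>C V (\<tau> (resolvent A0 w (G_op A0 \<tau> z (W y)))))"
    if z: "z \<in> resolvent_set A0" and w: "w \<in> resolvent_set A0" for z w y x
  proof -
    have "x' + (z - w) *\<^sub>C v = x' - (w - z) *\<^sub>C v" for x' v :: 'x
      by (simp add: complex_scale.scale_left_diff_distrib)
    then show ?thesis
      by (subst Q[OF z w]) (auto simp: G_adj_eq[OF A0 \<tau> w])
  qed
  \<comment> \<open>Condition (iii) evaluated at \<open>\<phi>'\<close>: the adjoints of
    \<open>V\<close> and \<open>W\<close> and the inverse of the adjoint of \<open>Q z\<close> all
    unfold into compositions.\<close>
  have L_adj: "dual_apply (W (?L (cnj z) (V \<phi>))) \<phi>' = cnj (dual_apply (W (?L z (V \<phi>'))) \<phi>)"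
    if z: "z \<in> ?Z" for z \<phi> \<phi>'
    using arg_cong[OF Q_adj[OF z, of \<phi>], of "\<lambda>\<psi>. dual_apply \<psi> \<phi>'"]
    by (simp add: dual_apply_adjoint_pairing[OF V] op_inv_op_adjoint_pairing[OF L[OF z] Q_iff[OF z]]
        dual_apply_adjoint_copairing[OF W])
  \<comment> \<open>Condition (ii) is applied to the pair \<open>(?L z x, x)\<close> of
    \<open>Q z\<close>, and the resulting pair of \<open>Q w\<close> is inverted.\<close>
  have L_ident: "?L z x = ?L w (x + (w - z) *\<^sub>C V (\<tau> (resolvent A0 w (G_op A0 \<tau> z (W (?L z x))))))"
    if z: "z \<in> ?Z" and w: "w \<in> ?Z" for z w x
  proof -
    have "(?L z x, x) \<in> Q z" by (simp add: Q_iff[OF z])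
    then obtain x' where "?L z x = ?L w x'"
      "x = x' - (w - z) *\<^sub>C V (\<tau> (resolvent A0 w (G_op A0 \<tau> z (W (?L z x)))))"
      unfolding Q_mem[OF \<rho>[OF z] \<rho>[OF w]] Q_iff[OF w] by blast
    then show ?thesis by (metis diff_add_cancel)
  qed
  have Z_sub: "?Z \<subseteq> resolvent_set A0" using \<rho> by blast
  note A_props = A_Lambda_properties[where L="?L", OF A0 \<tau> V W assms(10) Z_sub cnjZ L L_adj L_ident,
      folded A_Q_def]
  have A: "self_adjoint ?A" by (rule A_props(1)) assumption+
  have A_sub: "?Z \<subseteq> resolvent_set ?A" by (rule A_props(2)) assumption+
  have A_res: "resolvent ?A z u =
      resolvent A0 z u + G_op A0 \<tau> z (W (?L z (V (\<tau> (resolvent A0 z u)))))" if "z \<in> ?Z" for z u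
    by (rule A_props(3); (assumption | rule that))
  note linA = self_adjoint_linear_op[OF A]
  have inv: "boundedly_invertible (Q z) \<and> ?L z = Lambda_hat A0 \<tau> V W Q w z"
    if z: "z \<in> resolvent_set A0" "z \<in> resolvent_set ?A" and w: "w \<in> ?Z" for z w
  proof (rule boundedly_invertibleI[OF sv[OF z(1)]])
    note wA = subsetD[OF A_sub w]
    let ?T = "\<lambda>u. V (\<tau> (resolvent A0 w u))" and ?U = "\<lambda>y. G_op A0 \<tau> w (W y)"
    have T: "bounded_clinear ?T"
      by (intro bounded_clinear_compose[OF V] bounded_clinear_trace_resolvent[OF lin \<tau> \<rho>[OF w]])
    have U: "bounded_clinear ?U"
      by (intro bounded_clinear_compose[OF bounded_clinear_G_op[OF A0 \<tau> \<rho>[OF w]] W])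
    have hat: "Lambda_hat A0 \<tau> V W Q w z x = ?L w x + (w - z) *\<^sub>C
        ?L w (?T (?U (?L w x) + (w - z) *\<^sub>C resolvent ?A z (?U (?L w x))))" for x
      by (simp add: Lambda_hat_def Let_def G_adj_eq[OF A0 \<tau> \<rho>[OF w]])
    \<comment> \<open>Expanding the operator \<open>G\<close> at \<open>z\<close> around
      \<open>w\<close> gives the perturbation of \<open>Q w\<close> the form \<open>c T P U\<close>
      with \<open>c = w - z\<close>. The relation between \<open>Rw\<close> and \<open>R0w\<close>
      is the resolvent formula at \<open>w\<close>, known because \<open>w\<close> lies in
      \<open>Z_Q\<close>.\<close>
    show "(y, x) \<in> Q z \<longleftrightarrow> y = Lambda_hat A0 \<tau> V W Q w z x" for y x
      unfolding hat Q_mem[OF z(1) \<rho>[OF w]] G_op_identity[OF A0 \<tau> z(1) \<rho>[OF w]]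
      by (rule inverse_of_perturbed_operator[OF T U L[OF w] Q_iff[OF w] A_res[OF w]
            resolvent_identity[OF linA z(2) wA] resolvent_identity'[OF linA z(2) wA]
            resolvent_identity[OF lin z(1) \<rho>[OF w]] resolvent_identity'[OF lin z(1) \<rho>[OF w]]])
    note UL = bounded_clinear_compose[OF U L[OF w]]
    show "bounded_clinear (Lambda_hat A0 \<tau> V W Q w z)"
      unfolding hat[abs_def]
      by (intro bounded_clinear_plus[OF L[OF w]] bounded_clinear_scale
          bounded_clinear_compose[OF L[OF w]] bounded_clinear_compose[OF T]
          bounded_clinear_plus[OF UL] bounded_clinear_compose[OF resolvent_clinear[OF z(2)] UL])
  qed
  have Z_eq: "?Z = resolvent_set A0 \<inter> resolvent_set ?A"
  proof
    show "?Z \<subseteq> resolvent_set A0 \<inter> resolvent_set ?A" using Z_sub A_sub by blast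
    obtain w where w: "w \<in> ?Z" using assms(10) by blast
    \<comment> \<open>\<open>Z_Q\<close> demands invertibility at \<open>z\<close> and at
      \<open>cnj z\<close>; both resolvent sets are symmetric, so \<open>inv\<close> applies at both
      points with the same \<open>w\<close>.\<close>
    show "resolvent_set A0 \<inter> resolvent_set ?A \<subseteq> ?Z"
      unfolding Z_Q_def
      using inv[OF _ _ w] cnj_resolvent_set[OF A0] cnj_resolvent_set[OF A] by blast
  qed
  show ?thesis
  proof (intro conjI ballI allI)
    fix z assume z: "z \<in> resolvent_set A0 \<inter> resolvent_set ?A"
    show "?L z = Lambda_hat A0 \<tau> V W Q w z" if "w \<in> ?Z" for w
      using inv[OF _ _ that] z by blast
    have zZ: "z \<in> ?Z" using z Z_eq by blast
    show "resolvent ?A z u =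
        resolvent A0 z u + G_op A0 \<tau> z (W (?L z (V (G_adj A0 \<tau> (cnj z) u))))" for u
      unfolding G_adj_eq[OF A0 \<tau> \<rho>[OF zZ]] by (rule A_res[OF zZ])
  qed (rule Z_eq)
qed

end
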